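(* Let the setting and standing assumptions in the context hold, and let $T\ge1$ be the total number of iterations. Choose the parameters, for all $t$, $$\gamma_t=\gamma\ge L,\qquad 0<\alpha_t=\alpha<\frac{\gamma\lambda}{8(G_f+2\gamma G_h+L_g)M_2^{\mathrm R}},\qquad |\mathcal B_t|=|\mathcal B|.$$ Then the sequence $\{x_t\}_{t=0}^{T-1}$ generated by the stochastic retraction-based Riemannian Bregman gradient method (described in the context) satisfies $$\frac1T\sum_{t=0}^{T-1}\mathbb E\left[\|v_t^{\mathrm R}\|^2\right]\ \le\ \mathcal O\!\left(\frac{F(x_0)-F^*}{T}+\frac{\sigma^2}{|\mathcal B|}\right),$$ where the expectation is over all the randomness and the constant hidden in $\mathcal O(\cdot)$ is independent of $T$, $|\mathcal B|$, $\sigma$ and $x_0$.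
   Context: Setting. $\mathcal M\subseteq\mathbb R^n$ is a compact $C^\infty$ embedded submanifold endowed with the Euclidean inner product on each tangent space $\mathcal T_x\mathcal M\subseteq\mathbb R^n$. The problem is $\min_{x\in\mathcal M}F(x)=f(x)+g(x)$, $f(x)=\mathbb E_\pi[f(x,\pi)]$, where $f:\mathbb R^n\to\mathbb R$ is continuously differentiable and $g:\mathbb R^n\to\mathbb R$ is convex and $L_g$-Lipschitz continuous; $F^*=\inf_{\mathcal M}F>-\infty$. Assumptions. $h:\mathbb R^n\to\mathbb R$ is continuously differentiable and $\lambda$-strongly convex, $\lambda>0$, with Bregman distance $D_h(y,x)=h(y)-h(x)-\langle\nabla h(x),y-x\rangle$. The function $f$ is $L$-smooth relative to $h$ ($L>0$): $f(y)\le f(x)+\langle\nabla f(x),y-x\rangle+L\,D_h(y,x)$ for all $x,y\in\mathbb R^n$. The stochastic oracle satisfies, for all $x\in\mathbb R^n$, $\mathbb E_\pi[\nabla f(x,\pi)]=\nabla f(x)$ and $\mathbb E_\pi[\|\nabla f(x,\pi)-\nabla f(x)\|^2]\le\sigma^2$, $\sigma>0$. Constants. $G_f=\max_{x\in\mathcal M}\|\nabla f(x)\|$, $G_h=\max_{x\in\mathcal M}\|\nabla h(x)\|$. A retraction is a smooth map $\operatorname{Retr}:\mathcal T\mathcal M\to\mathcal M$ with $\operatorname{Retr}(x,0)=x$ and differential of $\operatorname{Retr}(x,\cdot)$ at $0$ equal to the identity; one is fixed. By compactness there are uniform constants $M_1^{\mathrm R},M_2^{\mathrm R}>0$ with $\|\operatorname{Retr}(x,v)-x\|\le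 M_1^{\mathrm R}\|v\|$ and $\|\operatorname{Retr}(x,v)-(x+v)\|\le M_2^{\mathrm R}\|v\|^2$ for all $x\in\mathcal M$, $v\in\mathcal T_x\mathcal M$. Algorithm (stochastic retraction-based method). Given $x_0\in\mathcal M$, for $t=0,1,\dots$: draw a fresh mini-batch $\mathcal B_t$ of i.i.d. samples $\pi_t^{(j)}$ (independent of the past), set $\nabla f_{\mathcal B_t}(x_t)=\frac1{|\mathcal B_t|}\sum_{j\in\mathcal B_t}\nabla f(x_t,\pi_t^{(j)})$, compute $$\zeta_t^{\mathrm R}=\arg\min_{\zeta\in\mathcal T_{x_t}\mathcal M}\langle\nabla f_{\mathcal B_t}(x_t),\zeta\rangle+\gamma_tD_h(x_t+\zeta,x_t)+g(x_t+\zeta),$$ and set $x_{t+1}=\operatorname{Retr}(x_t,\alpha_t\zeta_t^{\mathrm R})$. Stationarity measure. $v_t^{\mathrm R}=\arg\min_{v\in\mathcal T_{x_t}\mathcal M}\langle\nabla f(x_t),v\rangle+\gamma_tD_h(x_t+v,x_t)+g(x_t+v)$ (exact gradient at $x_t$). *)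

theory Defs
  imports "HOL-Probability.Probability"
begin

section \<open>Smooth maps, embedded submanifolds, retractions\<close>

primrec Ck_on :: "nat \<Rightarrow> 'a::euclidean_space set \<Rightarrow> ('a \<Rightarrow> 'b::euclidean_space) \<Rightarrow> bool" where
  "Ck_on 0 U f \<longleftrightarrow> continuous_on U f"
| "Ck_on (Suc k) U f \<longleftrightarrow>
     (\<forall>x\<in>U. f differentiable (at x)) \<and>
     (\<forall>v. Ck_on k U (\<lambda>x. frechet_derivative f (at x) v))"

definition smooth_on :: "'a::euclidean_space set \<Rightarrow> ('a \<Rightarrow> 'b::euclidean_space) \<Rightarrow> bool" where
  "smooth_on U f \<longleftrightarrow> open U \<and> (\<forall>k. Ck_on k U f)"

text \<open>Smoothness on an arbitrary subset: locally the restriction of a smooth map of the ambient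
  space. On an embedded submanifold this is the usual notion of a smooth map.\<close>

definition smooth_on_subset :: "'a::euclidean_space set \<Rightarrow> ('a \<Rightarrow> 'b::euclidean_space) \<Rightarrow> bool" where
  "smooth_on_subset S f \<longleftrightarrow>
     (\<forall>p\<in>S. \<exists>W F. p \<in> W \<and> smooth_on W F \<and> (\<forall>q\<in>W \<inter> S. F q = f q))"

text \<open>The local slice condition: near each point a diffeomorphism between open sets of the
  ambient space flattens \<open>M\<close> to a \<open>d\<close>-dimensional linear subspace.\<close>

definition embedded_submanifold :: "nat \<Rightarrow> 'a::euclidean_space set \<Rightarrow> bool" where
  "embedded_submanifold d M \<longleftrightarrow>
     (\<forall>p\<in>M. \<exists>U V \<phi> \<psi> S. p \<in> U \<and>
        smooth_on U (\<phi> :: 'a \<Rightarrow> 'a) \<and> smooth_on V (\<psi> :: 'a \<Rightarrow> 'a) \<and> homeomorphism U V \<phi> \<psi> \<and>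
        subspace S \<and> dim S = d \<and> \<phi> ` (U \<inter> M) = V \<inter> S)"

definition tangent_space :: "'a::euclidean_space set \<Rightarrow> 'a \<Rightarrow> 'a set" where
  "tangent_space M x =
     {v. \<exists>e>0. \<exists>c :: real \<Rightarrow> 'a. smooth_on {-e<..<e} c \<and> c ` {-e<..<e} \<subseteq> M \<and>
           c 0 = x \<and> (c has_vector_derivative v) (at 0)}"

definition tangent_bundle :: "'a::euclidean_space set \<Rightarrow> ('a \<times> 'a) set" where
  "tangent_bundle M = Sigma M (tangent_space M)"

definition retraction_on_manifold ::
  "'a::euclidean_space set \<Rightarrow> ('a \<times> 'a \<Rightarrow> 'a) \<Rightarrow> bool" where
  "retraction_on_manifold M Retr \<longleftrightarrow>
     Retr ` tangent_bundle M \<subseteq> M \<and> smooth_on_subset (tangent_bundle M) Retr \<and>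
     (\<forall>x\<in>M. Retr (x, 0) = x \<and>
        ((\<lambda>v. Retr (x, v)) has_derivative (\<lambda>v. v)) (at 0 within tangent_space M x))"


section \<open>Gradients, strong convexity, Bregman distance\<close>

definition grad :: "('a::real_inner \<Rightarrow> real) \<Rightarrow> 'a \<Rightarrow> 'a" where
  "grad f x = (THE D. GDERIV f x :> D)"

definition continuously_differentiable :: "('a::real_inner \<Rightarrow> real) \<Rightarrow> bool" where
  "continuously_differentiable f \<longleftrightarrow>
     (\<forall>x. f differentiable (at x)) \<and> continuous_on UNIV (grad f)"

definition strongly_convex :: "real \<Rightarrow> ('a::real_inner \<Rightarrow> real) \<Rightarrow> bool" where
  "strongly_convex \<mu> h \<longleftrightarrow>
     (\<forall>x y. \<forall>s\<in>{0..1}. h ((1 - s) *\<^sub>R x + s *\<^sub>R y)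
        \<le> (1 - s) * h x + s * h y - \<mu> / 2 * s * (1 - s) * (norm (x - y))\<^sup>2)"

definition bregman :: "('a::real_inner \<Rightarrow> real) \<Rightarrow> 'a \<Rightarrow> 'a \<Rightarrow> real" where
  "bregman h y x = h y - h x - grad h x \<bullet> (y - x)"

definition relatively_smooth ::
  "real \<Rightarrow> ('a::real_inner \<Rightarrow> real) \<Rightarrow> ('a \<Rightarrow> real) \<Rightarrow> bool" where
  "relatively_smooth L h f \<longleftrightarrow>
     (\<forall>x y. f y \<le> f x + grad f x \<bullet> (y - x) + L * bregman h y x)"


section \<open>Stochastic oracle and samples\<close>

text \<open>\<open>fs x \<pi>\<close> is the sample function \<open>f(x,\<pi>)\<close>, where \<open>\<pi>\<close> has law \<open>P\<close>. The gradient is taken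
  in the first argument. Integrability is demanded wherever an expectation occurs, since the
  Bochner integral of a non-integrable function is \<open>0\<close> by convention.\<close>

definition stochastic_oracle ::
  "'p measure \<Rightarrow> ('a::euclidean_space \<Rightarrow> 'p \<Rightarrow> real) \<Rightarrow> ('a \<Rightarrow> real) \<Rightarrow> real \<Rightarrow> bool" where
  "stochastic_oracle P fs f \<sigma> \<longleftrightarrow>
     prob_space P \<and>
     (\<forall>\<pi>\<in>space P. \<forall>x. (\<lambda>y. fs y \<pi>) differentiable (at x)) \<and>
     (\<forall>x. integrable P (fs x) \<and> f x = (\<integral>\<pi>. fs x \<pi> \<partial>P)) \<and>
     (\<forall>x. integrable P (\<lambda>\<pi>. grad (\<lambda>y. fs y \<pi>) x) \<and>
          (\<integral>\<pi>. grad (\<lambda>y. fs y \<pi>) x \<partial>P) = grad f x) \<and>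
     (\<forall>x. integrable P (\<lambda>\<pi>. (norm (grad (\<lambda>y. fs y \<pi>) x - grad f x))\<^sup>2) \<and>
          (\<integral>\<pi>. (norm (grad (\<lambda>y. fs y \<pi>) x - grad f x))\<^sup>2 \<partial>P) \<le> \<sigma>\<^sup>2)"

text \<open>\<open>\<xi> t j\<close> is the \<open>j\<close>-th sample of the batch drawn at iteration \<open>t\<close>. Joint independence over
  all pairs \<open>(t, j)\<close> says that the samples of a batch are independent of each other and of all
  earlier batches, hence of the past iterates.\<close>

definition iid_samples ::
  "'w measure \<Rightarrow> 'p measure \<Rightarrow> (nat \<Rightarrow> nat \<Rightarrow> 'w \<Rightarrow> 'p) \<Rightarrow> (nat \<times> nat) set \<Rightarrow> bool" where
  "iid_samples \<Omega> P \<xi> I \<longleftrightarrow>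
     prob_space \<Omega> \<and>
     prob_space.indep_vars \<Omega> (\<lambda>_. P) (\<lambda>(t, j). \<xi> t j) I \<and>
     (\<forall>(t, j)\<in>I. \<xi> t j \<in> measurable \<Omega> P \<and> distr \<Omega> P (\<xi> t j) = P)"

definition batch_grad ::
  "('a::euclidean_space \<Rightarrow> 'p \<Rightarrow> real) \<Rightarrow> nat \<Rightarrow> (nat \<Rightarrow> 'p) \<Rightarrow> 'a \<Rightarrow> 'a" where
  "batch_grad fs b s x = (1 / real b) *\<^sub>R (\<Sum>j<b. grad (\<lambda>y. fs y (s j)) x)"


section \<open>The stochastic retraction-based method\<close>

text \<open>The subproblem with gradient (estimate) \<open>u\<close>. If \<open>h\<close> is strongly convex, \<open>g\<close> is convex, and
  \<open>\<gamma> > 0\<close>, then the minimiser over the linear space \<open>tangent_space M x\<close> exists and is unique, so the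
  choice made by \<^const>\<open>arg_min_on\<close> is immaterial.\<close>

definition bregman_direction ::
  "'a::euclidean_space set \<Rightarrow> ('a \<Rightarrow> real) \<Rightarrow> ('a \<Rightarrow> real) \<Rightarrow> real \<Rightarrow> 'a \<Rightarrow> 'a \<Rightarrow> 'a" where
  "bregman_direction M h g \<gamma> u x =
     arg_min_on (\<lambda>\<zeta>. u \<bullet> \<zeta> + \<gamma> * bregman h (x + \<zeta>) x + g (x + \<zeta>)) (tangent_space M x)"

text \<open>Iterate number \<open>t\<close> for one realisation \<open>s\<close> of the samples; the parameters \<open>\<gamma>\<close>, \<open>\<alpha>\<close>, \<open>b\<close>
  (batch size) may vary with the iteration.\<close>

primrec iterate ::
  "'a::euclidean_space set \<Rightarrow> ('a \<times> 'a \<Rightarrow> 'a) \<Rightarrow> ('a \<Rightarrow> real) \<Rightarrow> ('a \<Rightarrow> real) \<Rightarrow>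
   ('a \<Rightarrow> 'p \<Rightarrow> real) \<Rightarrow> (nat \<Rightarrow> real) \<Rightarrow> (nat \<Rightarrow> real) \<Rightarrow> (nat \<Rightarrow> nat) \<Rightarrow>
   (nat \<Rightarrow> nat \<Rightarrow> 'p) \<Rightarrow> 'a \<Rightarrow> nat \<Rightarrow> 'a" where
  "iterate M Retr h g fs \<gamma> \<alpha> b s x0 0 = x0"
| "iterate M Retr h g fs \<gamma> \<alpha> b s x0 (Suc t) =
     (let x = iterate M Retr h g fs \<gamma> \<alpha> b s x0 t;
          \<zeta> = bregman_direction M h g (\<gamma> t) (batch_grad fs (b t) (s t) x) x
      in Retr (x, \<alpha> t *\<^sub>R \<zeta>))"

text \<open>The exact-gradient direction \<open>v\<^sub>t\<close> at iterate \<open>t\<close>, whose norm is the stationarity measure.\<close>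

definition stationarity_direction ::
  "'a::euclidean_space set \<Rightarrow> ('a \<times> 'a \<Rightarrow> 'a) \<Rightarrow> ('a \<Rightarrow> real) \<Rightarrow> ('a \<Rightarrow> real) \<Rightarrow> ('a \<Rightarrow> real) \<Rightarrow>
   ('a \<Rightarrow> 'p \<Rightarrow> real) \<Rightarrow> (nat \<Rightarrow> real) \<Rightarrow> (nat \<Rightarrow> real) \<Rightarrow> (nat \<Rightarrow> nat) \<Rightarrow>
   (nat \<Rightarrow> nat \<Rightarrow> 'p) \<Rightarrow> 'a \<Rightarrow> nat \<Rightarrow> 'a" where
  "stationarity_direction M Retr h g f fs \<gamma> \<alpha> b s x0 t =
     (let x = iterate M Retr h g fs \<gamma> \<alpha> b s x0 t
      in bregman_direction M h g (\<gamma> t) (grad f x) x)"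

end

theory Submission
  imports Defs
begin

text \<open>The model at a point is \<open>\<gamma> \<mu>\<close>-strongly convex on the tangent space, so its minimiser \<open>\<zeta>\<close>
  for the gradient estimate \<open>grad f x + \<delta>\<close> satisfies a quadratic decrease, and it depends on the
  gradient with Lipschitz constant \<open>1 / (\<gamma> \<mu>)\<close>. Relative smoothness, with the second-order error of
  the retraction absorbed by the bound on \<open>\<alpha>\<close>, turns this into a pathwise bound of
  \<open>\<parallel>v\<^sub>t\<parallel>\<^sup>2\<close> by a multiple of \<open>F(x\<^sub>t) - F(x\<^sub>t\<^sub>+\<^sub>1)\<close> plus a multiple of \<open>\<parallel>\<delta>\<^sub>t\<parallel>\<^sup>2\<close>. The first part
  telescopes. Since \<open>x\<^sub>t\<close> depends only on the earlier batches, the second has expectation at most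
  \<open>\<sigma>\<^sup>2 / B\<close>. The convexity step needs \<open>\<alpha> \<le> 1\<close>, which follows from the bound on \<open>\<alpha>\<close> because
  \<open>\<mu> \<le> 8 G\<^sub>h M2\<close> unless the tangent space is trivial. Measurability of the iterates rests on the
  minimiser being continuous in the gradient and the base point, as tangent spaces vary
  continuously along an embedded submanifold.\<close>

section \<open>Gradients and strong convexity\<close>

text \<open>\<open>grad\<close> is a definite description, so it is meaningful only once the
  gradient exists uniquely. The vector with the derivative's values on \<open>Basis\<close> as
  coordinates gives existence, and uniqueness of the Frechet derivative gives the rest.\<close>

lemma has_derivative_grad:
  fixes f :: "'a::euclidean_space \<Rightarrow> real"
  assumes "f differentiable (at x)"
  shows "(f has_derivative (\<lambda>v. v \<bullet> grad f x)) (at x)"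
proof -
  obtain f' where f': "(f has_derivative f') (at x)"
    using assms by (auto simp: differentiable_def)
  then have lin: "linear f'" by (rule has_derivative_linear)
  define D where "D = (\<Sum>i\<in>Basis. f' i *\<^sub>R i)"
  have "f' = (\<lambda>v. v \<bullet> D)"
  proof
    fix v
    have "f' v = f' (\<Sum>i\<in>Basis. (v \<bullet> i) *\<^sub>R i)" by (simp add: euclidean_representation)
    also have "\<dots> = (\<Sum>i\<in>Basis. (v \<bullet> i) * f' i)"
      by (simp add: linear_sum[OF lin] linear_cmul[OF lin])
    also have "\<dots> = v \<bullet> D" by (simp add: D_def inner_sum_right mult.commute)
    finally show "f' v = v \<bullet> D" .
  qed
  with f' have D: "GDERIV f x :> D" by (simp add: gderiv_def)
  have "grad f x = D"
    unfolding grad_def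
  proof (rule the_equality[where P = "\<lambda>D. GDERIV f x :> D", OF D])
    fix E assume "GDERIV f x :> E"
    then have "(\<lambda>v. v \<bullet> E) = (\<lambda>v. v \<bullet> D)"
      using D by (auto simp: gderiv_def intro: has_derivative_unique)
    then have "v \<bullet> E = v \<bullet> D" for v by meson
    then have "(E - D) \<bullet> (E - D) = 0" by (simp only: inner_diff_right diff_self)
    then show "E = D" by simp
  qed
  with D show ?thesis by (simp add: gderiv_def)
qed

text \<open>Serves two purposes: the first-order form of strong convexity, and measurability of
  sample gradients as limits of difference quotients.\<close>

lemma difference_quotient_tendsto_grad:
  fixes f :: "'a::euclidean_space \<Rightarrow> real"
  assumes "f differentiable (at x)"
  shows "((\<lambda>s. (f (x + s *\<^sub>R v) - f x) / s) \<longlongrightarrow> v \<bullet> grad f x) (at 0)"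
proof -
  have "((\<lambda>s. f (x + s *\<^sub>R v)) has_derivative (\<lambda>s. (s *\<^sub>R v) \<bullet> grad f x)) (at 0)"
    by (rule has_derivative_compose[where g = f and f = "\<lambda>s. x + s *\<^sub>R v", simplified])
       (auto intro!: derivative_eq_intros has_derivative_grad assms)
  then have "((\<lambda>s. f (x + s *\<^sub>R v)) has_real_derivative v \<bullet> grad f x) (at 0)"
    by (simp add: has_field_derivative_def mult_commute_abs)
  then show ?thesis by (simp add: has_field_derivative_iff)
qed

text \<open>A real \<open>SUP\<close> bounds its members only if the set is bounded above. This
  turns the suprema \<open>G\<^sub>f\<close> and \<open>G\<^sub>h\<close> into usable
  bounds.\<close>

lemma bdd_above_norm_grad:
  fixes f :: "'a::euclidean_space \<Rightarrow> real"
  assumes "compact M" "continuously_differentiable f"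
  shows "bdd_above ((\<lambda>x. norm (grad f x)) ` M)"
proof -
  have "continuous_on M (grad f)"
    using assms(2) by (auto simp: continuously_differentiable_def intro: continuous_on_subset)
  then have "compact ((\<lambda>x. norm (grad f x)) ` M)"
    using assms(1) by (intro compact_continuous_image continuous_intros)
  then show ?thesis by (intro bounded_imp_bdd_above compact_imp_bounded)
qed

text \<open>Divide the defining inequality on the segment from \<open>x\<close> to \<open>y\<close>
  by \<open>s\<close> and let \<open>s\<close> tend to 0 from the right. The factor
  \<open>1 - s\<close> of the quadratic term tends to 1.\<close>

lemma strongly_convex_first_order:
  fixes h :: "'a::euclidean_space \<Rightarrow> real"
  assumes "strongly_convex \<mu> h" "h differentiable (at x)"
  shows "h x + grad h x \<bullet> (y - x) + \<mu> / 2 * (norm (y - x))\<^sup>2 \<le> h y"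
proof -
  have "((\<lambda>s. (h (x + s *\<^sub>R (y - x)) - h x) / s) \<longlongrightarrow> (y - x) \<bullet> grad h x) (at_right 0)"
    using difference_quotient_tendsto_grad[OF assms(2)]
    by (rule filterlim_mono) (auto intro: at_le)
  moreover have "((\<lambda>s. h y - h x - \<mu> / 2 * (1 - s) * (norm (x - y))\<^sup>2) \<longlongrightarrow>
      h y - h x - \<mu> / 2 * (1 - 0) * (norm (x - y))\<^sup>2) (at_right 0)"
    by (intro tendsto_intros)
  moreover have "eventually (\<lambda>s. (h (x + s *\<^sub>R (y - x)) - h x) / s
      \<le> h y - h x - \<mu> / 2 * (1 - s) * (norm (x - y))\<^sup>2) (at_right 0)"
  proof (rule eventually_at_rightI[of 0 1])
    fix s :: real assume s: "s \<in> {0<..<1}"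
    then have "h ((1 - s) *\<^sub>R x + s *\<^sub>R y)
        \<le> (1 - s) * h x + s * h y - \<mu> / 2 * s * (1 - s) * (norm (x - y))\<^sup>2"
      using assms(1) by (auto simp: strongly_convex_def)
    moreover have "(1 - s) *\<^sub>R x + s *\<^sub>R y = x + s *\<^sub>R (y - x)" by (simp add: algebra_simps)
    ultimately show "(h (x + s *\<^sub>R (y - x)) - h x) / s
        \<le> h y - h x - \<mu> / 2 * (1 - s) * (norm (x - y))\<^sup>2"
      using s by (simp add: field_simps)
  qed simp
  ultimately have "(y - x) \<bullet> grad h x \<le> h y - h x - \<mu> / 2 * (1 - 0) * (norm (x - y))\<^sup>2"
    by (intro tendsto_le[OF trivial_limit_at_right_real])
  then show ?thesis by (simp add: norm_minus_commute inner_commute)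
qed

text \<open>Stated without derivatives because the model contains the nonsmooth \<open>g\<close>.
  The minimiser is compared with points of the segment towards \<open>w\<close>, the inequality is
  divided by \<open>s\<close>, and \<open>s\<close> tends to 0.\<close>

lemma strongly_convex_minimizer:
  fixes \<phi> :: "'a::euclidean_space \<Rightarrow> real"
  assumes sc: "strongly_convex m \<phi>" and S: "convex S" and z: "z \<in> S" and w: "w \<in> S"
    and min: "\<And>y. y \<in> S \<Longrightarrow> \<phi> z \<le> \<phi> y"
  shows "\<phi> z + m / 2 * (norm (w - z))\<^sup>2 \<le> \<phi> w"
proof -
  have "((\<lambda>s. \<phi> w - \<phi> z - m / 2 * (1 - s) * (norm (z - w))\<^sup>2) \<longlongrightarrow>
      \<phi> w - \<phi> z - m / 2 * (1 - 0) * (norm (z - w))\<^sup>2) (at_right 0)"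
    by (intro tendsto_intros)
  moreover have "eventually (\<lambda>s. 0 \<le> \<phi> w - \<phi> z - m / 2 * (1 - s) * (norm (z - w))\<^sup>2) (at_right 0)"
  proof (rule eventually_at_rightI[of 0 1])
    fix s :: real assume s: "s \<in> {0<..<1}"
    then have "\<phi> z \<le> \<phi> ((1 - s) *\<^sub>R z + s *\<^sub>R w)"
      using S z w by (intro min) (auto simp: convex_alt)
    also have "\<dots> \<le> (1 - s) * \<phi> z + s * \<phi> w - m / 2 * s * (1 - s) * (norm (z - w))\<^sup>2"
      using sc s by (auto simp: strongly_convex_def)
    finally have "0 \<le> s * (\<phi> w - \<phi> z - m / 2 * (1 - s) * (norm (z - w))\<^sup>2)"
      by (simp add: algebra_simps)
    then show "0 \<le> \<phi> w - \<phi> z - m / 2 * (1 - s) * (norm (z - w))\<^sup>2"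
      using s by (simp add: zero_le_mult_iff)
  qed simp
  ultimately have "0 \<le> \<phi> w - \<phi> z - m / 2 * (1 - 0) * (norm (z - w))\<^sup>2"
    by (intro tendsto_lowerbound) auto
  then show ?thesis by (simp add: norm_minus_commute)
qed

section \<open>The subproblem\<close>

locale bregman_model =
  fixes h g :: "'a::euclidean_space \<Rightarrow> real" and \<gamma> \<mu> L\<^sub>g :: real
  assumes h_diff: "continuously_differentiable h"
    and mu_pos: "\<mu> > 0" and h_sc: "strongly_convex \<mu> h"
    and g_convex: "convex_on UNIV g" and g_lip: "L\<^sub>g-lipschitz_on UNIV g"
    and gamma_pos: "\<gamma> > 0"
begin

text \<open>Gradient and base point are kept as explicit arguments, since the minimiser is later
  studied as a function of both.\<close>

definition model :: "'a \<Rightarrow> 'a \<Rightarrow> 'a \<Rightarrow> real" where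
  "model u x \<zeta> = u \<bullet> \<zeta> + \<gamma> * bregman h (x + \<zeta>) x + g (x + \<zeta>)"

lemma gamma_mu_pos: "\<gamma> * \<mu> > 0"
  using gamma_pos mu_pos by simp

lemma h_differentiable: "h differentiable (at x)"
  using h_diff by (simp add: continuously_differentiable_def)

lemma bregman_ge: "\<mu> / 2 * (norm (y - x))\<^sup>2 \<le> bregman h y x"
  using strongly_convex_first_order[OF h_sc h_differentiable, of x y] by (simp add: bregman_def)

lemma bregman_nonneg: "0 \<le> bregman h y x"
  by (rule order_trans[OF _ bregman_ge]) (use mu_pos in simp)

lemma continuous_h: "continuous_on UNIV h"
  by (simp add: continuous_at_imp_continuous_on differentiable_imp_continuous_within h_differentiable)

lemma continuous_g: "continuous_on UNIV g"
  using g_lip by (rule lipschitz_on_continuous_on)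

lemma Lg_nonneg: "0 \<le> L\<^sub>g"
  using g_lip by (rule lipschitz_on_nonneg)

lemma g_diff_le: "\<bar>g y - g x\<bar> \<le> L\<^sub>g * norm (y - x)"
  using lipschitz_onD[OF g_lip, of y x] by (simp add: dist_norm)

lemma model_zero: "model u x 0 = g x"
  by (simp add: model_def bregman_def)

text \<open>The term in \<open>h\<close> contributes the modulus \<open>\<gamma> * \<mu>\<close> and
  \<open>g\<close> is convex. Everything else is affine in the direction.\<close>

lemma strongly_convex_model: "strongly_convex (\<gamma> * \<mu>) (model u x)"
  unfolding strongly_convex_def
proof (intro allI ballI)
  fix a b :: 'a and s :: real assume s: "s \<in> {0..1}"
  have eq: "x + ((1 - s) *\<^sub>R a + s *\<^sub>R b) = (1 - s) *\<^sub>R (x + a) + s *\<^sub>R (x + b)"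
    by (simp add: algebra_simps)
  have "h (x + ((1 - s) *\<^sub>R a + s *\<^sub>R b))
      \<le> (1 - s) * h (x + a) + s * h (x + b) - \<mu> / 2 * s * (1 - s) * (norm (a - b))\<^sup>2"
    unfolding eq using h_sc[unfolded strongly_convex_def, rule_format, OF s, of "x + a" "x + b"]
    by simp
  from mult_left_mono[OF this less_imp_le[OF gamma_pos]]
  have 1: "\<gamma> * h (x + ((1 - s) *\<^sub>R a + s *\<^sub>R b))
      \<le> (1 - s) * (\<gamma> * h (x + a)) + s * (\<gamma> * h (x + b))
        - \<gamma> * \<mu> / 2 * s * (1 - s) * (norm (a - b))\<^sup>2"
    by (simp add: algebra_simps)
  have 2: "g (x + ((1 - s) *\<^sub>R a + s *\<^sub>R b)) \<le> (1 - s) * g (x + a) + s * g (x + b)"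
    unfolding eq using g_convex s by (auto simp: convex_on_def)
  show "model u x ((1 - s) *\<^sub>R a + s *\<^sub>R b) \<le> (1 - s) * model u x a + s * model u x b
      - \<gamma> * \<mu> / 2 * s * (1 - s) * (norm (a - b))\<^sup>2"
    using add_mono[OF 1 2]
    by (simp add: model_def bregman_def inner_add_right algebra_simps)
qed

text \<open>Coercivity: the quadratic growth of the Bregman term dominates the linear loss from
  \<open>u\<close> and from the Lipschitz function \<open>g\<close>.\<close>

lemma model_lower_bound:
  "g x - (norm u + L\<^sub>g) * norm \<zeta> + \<gamma> * \<mu> / 2 * (norm \<zeta>)\<^sup>2 \<le> model u x \<zeta>"
proof -
  have "- (norm u * norm \<zeta>) \<le> u \<bullet> \<zeta>" using Cauchy_Schwarz_ineq2[of u \<zeta>] by linarith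
  moreover have "\<gamma> * (\<mu> / 2 * (norm \<zeta>)\<^sup>2) \<le> \<gamma> * bregman h (x + \<zeta>) x"
    using bregman_ge[of "x + \<zeta>" x] gamma_pos by (intro mult_left_mono) auto
  moreover have "g x - L\<^sub>g * norm \<zeta> \<le> g (x + \<zeta>)" using g_diff_le[of "x + \<zeta>" x] by simp
  ultimately show ?thesis by (simp add: model_def algebra_simps)
qed

lemma continuous_model:
  assumes "continuous_on A p" "continuous_on A q" "continuous_on A r"
  shows "continuous_on A (\<lambda>y. model (p y) (q y) (r y))"
proof -
  have h: "continuous_on A (\<lambda>y. h (k y))" if "continuous_on A k" for k
    using continuous_on_compose2[OF continuous_h that] by simp
  have g: "continuous_on A (\<lambda>y. g (k y))" if "continuous_on A k" for k
    using continuous_on_compose2[OF continuous_g that] by simp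
  have gr: "continuous_on A (\<lambda>y. grad h (k y))" if "continuous_on A k" for k
    using that h_diff
    by (intro continuous_on_compose2[of UNIV "grad h" A k]) (auto simp: continuously_differentiable_def)
  show ?thesis
    unfolding model_def bregman_def by (intro continuous_intros h g gr assms)
qed

text \<open>The level \<open>g x\<close> is the model value at 0. Its sublevel set lies in a ball
  whose radius depends on \<open>u\<close> but not on \<open>x\<close>, which later yields bounds
  uniform over the manifold.\<close>

lemma model_radius:
  assumes "model u x \<zeta> \<le> g x"
  shows "norm \<zeta> \<le> 2 * (norm u + L\<^sub>g) / (\<gamma> * \<mu>)"
proof (cases "\<zeta> = 0")
  case True
  then show ?thesis using Lg_nonneg gamma_mu_pos by simp
next
  case False
  have "norm \<zeta> * (\<gamma> * \<mu> / 2 * norm \<zeta>) \<le> norm \<zeta> * (norm u + L\<^sub>g)"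
    using model_lower_bound[of x u \<zeta>] assms by (simp add: algebra_simps power2_eq_square)
  then have "\<gamma> * \<mu> / 2 * norm \<zeta> \<le> norm u + L\<^sub>g" using False by simp
  then show ?thesis using gamma_mu_pos by (simp add: field_simps)
qed

text \<open>Minimise over the compact part of \<open>S\<close> inside the ball of
  \<open>model_radius\<close>. A point of \<open>S\<close> outside has a value above
  \<open>g x\<close>, so it loses to 0, which is in the ball.\<close>

lemma model_has_minimizer:
  assumes "subspace S"
  shows "\<exists>z\<in>S. \<forall>w\<in>S. model u x z \<le> model u x w"
proof -
  let ?R = "2 * (norm u + L\<^sub>g) / (\<gamma> * \<mu>)"
  have R: "0 \<le> ?R" using Lg_nonneg gamma_mu_pos by simp
  have "compact (S \<inter> cball 0 ?R)"
    using closed_subspace[OF assms] by (intro closed_Int_compact) auto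
  moreover have "0 \<in> S \<inter> cball 0 ?R" using subspace_0[OF assms] R by simp
  moreover have "continuous_on (S \<inter> cball 0 ?R) (model u x)"
    by (intro continuous_model continuous_intros)
  ultimately obtain z where z: "z \<in> S \<inter> cball 0 ?R"
    and min: "\<And>w. w \<in> S \<inter> cball 0 ?R \<Longrightarrow> model u x z \<le> model u x w"
    using continuous_attains_inf[of "S \<inter> cball 0 ?R" "model u x"] by blast
  have "model u x z \<le> model u x w" if "w \<in> S" for w
  proof (cases "model u x w \<le> g x")
    case True
    then show ?thesis using that model_radius by (intro min) auto
  next
    case False
    have "model u x z \<le> model u x 0" using \<open>0 \<in> S \<inter> cball 0 ?R\<close> by (rule min)
    with False show ?thesis by (simp add: model_zero)
  qed
  with z show ?thesis by blast
qed

lemma bregman_direction_arg_min: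
  "bregman_direction M h g \<gamma> u x = arg_min_on (model u x) (tangent_space M x)"
  by (simp add: bregman_direction_def model_def[abs_def])

text \<open>\<open>arg_min_on\<close> is a choice operator, so it has the properties of a minimiser
  only after existence has been shown.\<close>

lemma
  assumes "subspace (tangent_space M x)"
  shows bregman_direction_in: "bregman_direction M h g \<gamma> u x \<in> tangent_space M x"
    and bregman_direction_le:
      "w \<in> tangent_space M x \<Longrightarrow> model u x (bregman_direction M h g \<gamma> u x) \<le> model u x w"
proof -
  let ?P = "is_arg_min (model u x) (\<lambda>\<zeta>. \<zeta> \<in> tangent_space M x)"
  have "\<exists>z. ?P z" using model_has_minimizer[OF assms, of u x] by (auto simp: is_arg_min_linorder)
  then have "?P (bregman_direction M h g \<gamma> u x)"
    unfolding bregman_direction_arg_min arg_min_on_def arg_min_def by (rule someI_ex)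
  then show "bregman_direction M h g \<gamma> u x \<in> tangent_space M x"
    and "w \<in> tangent_space M x \<Longrightarrow> model u x (bregman_direction M h g \<gamma> u x) \<le> model u x w"
    by (auto simp: is_arg_min_linorder)
qed

text \<open>Applied with \<open>w = 0\<close> this is the quadratic decrease. Applied to another
  minimiser it gives uniqueness and Lipschitz dependence on the gradient.\<close>

lemma bregman_direction_strong:
  assumes "subspace (tangent_space M x)" "w \<in> tangent_space M x"
  shows "model u x (bregman_direction M h g \<gamma> u x)
    + \<gamma> * \<mu> / 2 * (norm (w - bregman_direction M h g \<gamma> u x))\<^sup>2 \<le> model u x w"
  using bregman_direction_in[OF assms(1)] bregman_direction_le[OF assms(1)] assms
  by (intro strongly_convex_minimizer[OF strongly_convex_model, of "tangent_space M x"])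
     (auto intro: subspace_imp_convex)

lemma bregman_direction_unique:
  assumes "subspace (tangent_space M x)" "w \<in> tangent_space M x"
    and "\<And>y. y \<in> tangent_space M x \<Longrightarrow> model u x w \<le> model u x y"
  shows "bregman_direction M h g \<gamma> u x = w"
proof -
  let ?z = "bregman_direction M h g \<gamma> u x"
  have "model u x ?z + \<gamma> * \<mu> / 2 * (norm (w - ?z))\<^sup>2 \<le> model u x w"
    using assms by (intro bregman_direction_strong)
  also have "\<dots> \<le> model u x ?z" using assms bregman_direction_in by blast
  finally have *: "\<gamma> * \<mu> / 2 * (norm (w - ?z))\<^sup>2 \<le> 0" by simp
  show ?thesis
  proof (rule ccontr)
    assume "?z \<noteq> w"
    then have "0 < \<gamma> * \<mu> / 2 * (norm (w - ?z))\<^sup>2"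
      using gamma_mu_pos by (intro mult_pos_pos) auto
    with * show False by linarith
  qed
qed

lemma bregman_direction_norm:
  assumes "subspace (tangent_space M x)"
  shows "norm (bregman_direction M h g \<gamma> u x) \<le> 2 * (norm u + L\<^sub>g) / (\<gamma> * \<mu>)"
  using bregman_direction_le[OF assms subspace_0[OF assms], of u]
  by (intro model_radius) (simp add: model_zero)

text \<open>Test each minimiser against the other and add the two strong inequalities. All terms
  except the linear ones cancel, and Cauchy-Schwarz finishes.\<close>

lemma bregman_direction_lipschitz:
  assumes S: "subspace (tangent_space M x)"
  shows "norm (bregman_direction M h g \<gamma> u x - bregman_direction M h g \<gamma> v x)
    \<le> norm (u - v) / (\<gamma> * \<mu>)"
proof -
  let ?z = "bregman_direction M h g \<gamma> u x" and ?w = "bregman_direction M h g \<gamma> v x"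
  have "model u x ?z + \<gamma> * \<mu> / 2 * (norm (?w - ?z))\<^sup>2 \<le> model u x ?w"
    by (rule bregman_direction_strong[OF S bregman_direction_in[OF S]])
  moreover have "model v x ?w + \<gamma> * \<mu> / 2 * (norm (?z - ?w))\<^sup>2 \<le> model v x ?z"
    by (rule bregman_direction_strong[OF S bregman_direction_in[OF S]])
  ultimately have "\<gamma> * \<mu> * (norm (?z - ?w))\<^sup>2 \<le> (u - v) \<bullet> (?w - ?z)"
    by (simp add: model_def norm_minus_commute algebra_simps inner_diff_left inner_diff_right)
  also have "\<dots> \<le> norm (u - v) * norm (?z - ?w)"
    using norm_cauchy_schwarz[of "u - v" "?w - ?z"] by (simp add: norm_minus_commute)
  finally have *: "norm (?z - ?w) * (\<gamma> * \<mu> * norm (?z - ?w)) \<le> norm (?z - ?w) * norm (u - v)"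
    by (simp add: power2_eq_square algebra_simps)
  show ?thesis
  proof (cases "?z = ?w")
    case True then show ?thesis using gamma_mu_pos by simp
  next
    case False
    with * have "\<gamma> * \<mu> * norm (?z - ?w) \<le> norm (u - v)" by simp
    then show ?thesis using gamma_mu_pos by (simp add: field_simps)
  qed
qed

end

section \<open>Tangent spaces of embedded submanifolds\<close>

lemma Ck_on_subset: "Ck_on k U f \<Longrightarrow> V \<subseteq> U \<Longrightarrow> Ck_on k V f"
  by (induction k arbitrary: f) (auto intro: continuous_on_subset)

lemma Ck_on_cong:
  assumes "open U" "\<And>x. x \<in> U \<Longrightarrow> f x = f' x"
  shows "Ck_on k U f \<longleftrightarrow> Ck_on k U f'"
  using assms(2)
proof (induction k arbitrary: f f')
  case 0
  then show ?case by (simp cong: continuous_on_cong)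
next
  case (Suc k)
  have D: "(f has_derivative D) (at x) \<longleftrightarrow> (f' has_derivative D) (at x)" if "x \<in> U" for x D
    using Suc.prems that assms(1)
    by (auto intro: has_derivative_transform_within_open[of _ _ _ _ U])
  then have "frechet_derivative f (at x) v = frechet_derivative f' (at x) v" if "x \<in> U" for x v
    using that by (simp add: frechet_derivative_def)
  then have "Ck_on k U (\<lambda>x. frechet_derivative f (at x) v)
      \<longleftrightarrow> Ck_on k U (\<lambda>x. frechet_derivative f' (at x) v)" for v
    by (intro Suc.IH)
  with D show ?case by (simp add: differentiable_def)
qed

text \<open>The derivative along the line, applied to \<open>s\<close>, is the derivative of \<psi>
  in the fixed direction \<open>s *\<^sub>R w\<close> composed with the same line, so the induction
  hypothesis covers it. The result supplies the smooth curves demanded by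
  \<open>tangent_space\<close>.\<close>

lemma Ck_on_compose_line:
  fixes \<psi> :: "'a::euclidean_space \<Rightarrow> 'b::euclidean_space"
  assumes "open V" "Ck_on k V \<psi>"
  shows "Ck_on k {t. a + t *\<^sub>R w \<in> V} (\<lambda>t. \<psi> (a + t *\<^sub>R w))"
  using assms(2)
proof (induction k arbitrary: \<psi>)
  case 0
  then have "continuous_on V \<psi>" by simp
  then have "continuous_on {t. a + t *\<^sub>R w \<in> V} (\<lambda>t. \<psi> (a + t *\<^sub>R w))"
    by (rule continuous_on_compose2) (auto intro!: continuous_intros)
  then show ?case by simp
next
  case (Suc k)
  let ?W = "{t. a + t *\<^sub>R w \<in> V}"
  have W: "open ?W"
    using open_vimage[OF assms(1), of "\<lambda>t. a + t *\<^sub>R w"]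
    by (simp add: vimage_def continuous_intros)
  have D: "((\<lambda>t. \<psi> (a + t *\<^sub>R w)) has_derivative
      (\<lambda>s. frechet_derivative \<psi> (at (a + t *\<^sub>R w)) (s *\<^sub>R w))) (at t)" if "t \<in> ?W" for t
  proof -
    have "(\<psi> has_derivative frechet_derivative \<psi> (at (a + t *\<^sub>R w))) (at (a + t *\<^sub>R w))"
      using Suc.prems that by (auto simp: frechet_derivative_works)
    then show ?thesis
      by (rule has_derivative_compose[rotated]) (auto intro!: derivative_eq_intros)
  qed
  have "Ck_on k ?W (\<lambda>t. frechet_derivative (\<lambda>t. \<psi> (a + t *\<^sub>R w)) (at t) s)" for s
  proof -
    have "Ck_on k V (\<lambda>y. frechet_derivative \<psi> (at y) (s *\<^sub>R w))"
      using Suc.prems by simp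
    then have "Ck_on k ?W (\<lambda>t. frechet_derivative \<psi> (at (a + t *\<^sub>R w)) (s *\<^sub>R w))"
      by (rule Suc.IH)
    moreover have "frechet_derivative \<psi> (at (a + t *\<^sub>R w)) (s *\<^sub>R w)
        = frechet_derivative (\<lambda>t. \<psi> (a + t *\<^sub>R w)) (at t) s" if "t \<in> ?W" for t
      using fun_cong[OF frechet_derivative_at[OF D[OF that]]] .
    ultimately show ?thesis by (rule Ck_on_cong[OF W, THEN iffD1, rotated])
  qed
  with D show ?case by (auto simp: differentiable_def)
qed

lemma smooth_on_has_derivative:
  assumes "smooth_on U f" "x \<in> U"
  shows "(f has_derivative frechet_derivative f (at x)) (at x)"
proof -
  have "Ck_on (Suc 0) U f" using assms(1) unfolding smooth_on_def by blast
  then show ?thesis using assms(2) by (simp add: frechet_derivative_works)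
qed

text \<open>\<open>Ck_on\<close> gives continuity of the derivative only for each fixed direction.
  Expanding the direction in \<open>Basis\<close> upgrades this to joint continuity in point and
  direction.\<close>

lemma smooth_on_tendsto_frechet_derivative:
  assumes "smooth_on U f" "x \<in> U" "X \<longlonglongrightarrow> x" "Y \<longlonglongrightarrow> y"
  shows "(\<lambda>n. frechet_derivative f (at (X n)) (Y n)) \<longlonglongrightarrow> frechet_derivative f (at x) y"
proof -
  have U: "open U" and "Ck_on (Suc 0) U f" using assms(1) unfolding smooth_on_def by auto
  then have cont: "isCont (\<lambda>z. frechet_derivative f (at z) v) x" for v
    using assms(2) by (simp add: continuous_on_eq_continuous_at)
  have ev: "eventually (\<lambda>n. X n \<in> U) sequentially"
    using assms(2,3) U by (rule topological_tendstoD[rotated 2])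
  have lin: "linear (frechet_derivative f (at z))" if "z \<in> U" for z
    using smooth_on_has_derivative[OF assms(1) that] by (rule has_derivative_linear)
  have expand: "frechet_derivative f (at z) v = (\<Sum>i\<in>Basis. (v \<bullet> i) *\<^sub>R frechet_derivative f (at z) i)"
    if "z \<in> U" for z v
  proof -
    have "frechet_derivative f (at z) v = frechet_derivative f (at z) (\<Sum>i\<in>Basis. (v \<bullet> i) *\<^sub>R i)"
      by (simp add: euclidean_representation)
    then show ?thesis using lin[OF that] by (simp add: linear_sum linear_cmul)
  qed
  have "(\<lambda>n. \<Sum>i\<in>Basis. (Y n \<bullet> i) *\<^sub>R frechet_derivative f (at (X n)) i)
      \<longlonglongrightarrow> (\<Sum>i\<in>Basis. (y \<bullet> i) *\<^sub>R frechet_derivative f (at x) i)"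
    by (intro tendsto_intros assms isCont_tendsto_compose[OF cont])
  moreover have "eventually (\<lambda>n. (\<Sum>i\<in>Basis. (Y n \<bullet> i) *\<^sub>R frechet_derivative f (at (X n)) i)
      = frechet_derivative f (at (X n)) (Y n)) sequentially"
    using ev by eventually_elim (simp add: expand[symmetric])
  ultimately show ?thesis
    using assms(2) by (auto simp: expand[symmetric] intro: Lim_transform_eventually)
qed

text \<open>One local flattening of \<open>M\<close>. Through it the tangent space at a point
  becomes the preimage of the fixed subspace \<open>S\<close> under the derivative of
  \<phi>.\<close>

locale slice_chart =
  fixes M :: "'a::euclidean_space set" and U V :: "'a set" and \<phi> \<psi> :: "'a \<Rightarrow> 'a" and S :: "'a set"
  assumes smooth: "smooth_on U \<phi>" "smooth_on V \<psi>"
    and homeo: "homeomorphism U V \<phi> \<psi>"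
    and S: "subspace S" and slice: "\<phi> ` (U \<inter> M) = V \<inter> S"
begin

abbreviation "D\<phi> x \<equiv> frechet_derivative \<phi> (at x)"
abbreviation "D\<psi> y \<equiv> frechet_derivative \<psi> (at y)"

lemma open_UV: "open U" "open V"
  using smooth by (auto simp: smooth_on_def)

text \<open>Chain rule applied to both compositions of \<phi> and \<psi>, each of which is the
  identity on an open set.\<close>

lemma chart_inverse:
  assumes "x \<in> U"
  shows "D\<psi> (\<phi> x) (D\<phi> x v) = v" "D\<phi> x (D\<psi> (\<phi> x) v) = v"
proof -
  have V: "\<phi> x \<in> V" and inv: "\<psi> (\<phi> x) = x" using homeo assms by (auto simp: homeomorphism_def)
  have "((\<lambda>z. \<psi> (\<phi> z)) has_derivative (\<lambda>v. D\<psi> (\<phi> x) (D\<phi> x v))) (at x)"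
    using smooth_on_has_derivative[OF smooth(1) assms] smooth_on_has_derivative[OF smooth(2) V]
    by (rule has_derivative_compose)
  then have "((\<lambda>z. z) has_derivative (\<lambda>v. D\<psi> (\<phi> x) (D\<phi> x v))) (at x)"
    by (rule has_derivative_transform_within_open[OF _ open_UV(1) assms])
       (use homeo in \<open>auto simp: homeomorphism_def\<close>)
  then have "(\<lambda>v. D\<psi> (\<phi> x) (D\<phi> x v)) = (\<lambda>v. v)"
    by (rule has_derivative_unique) (rule has_derivative_ident)
  then show "D\<psi> (\<phi> x) (D\<phi> x v) = v" by meson
  have "(\<phi> has_derivative D\<phi> x) (at (\<psi> (\<phi> x)))"
    using smooth_on_has_derivative[OF smooth(1) assms] inv by simp
  with smooth_on_has_derivative[OF smooth(2) V]
  have "((\<lambda>z. \<phi> (\<psi> z)) has_derivative (\<lambda>v. D\<phi> x (D\<psi> (\<phi> x) v))) (at (\<phi> x))"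
    by (rule has_derivative_compose)
  then have "((\<lambda>z. z) has_derivative (\<lambda>v. D\<phi> x (D\<psi> (\<phi> x) v))) (at (\<phi> x))"
    by (rule has_derivative_transform_within_open[OF _ open_UV(2) V])
       (use homeo in \<open>auto simp: homeomorphism_def\<close>)
  then have "(\<lambda>v. D\<phi> x (D\<psi> (\<phi> x) v)) = (\<lambda>v. v)"
    by (rule has_derivative_unique) (rule has_derivative_ident)
  then show "D\<phi> x (D\<psi> (\<phi> x) v) = v" by meson
qed

text \<open>The chart sends the curve into \<open>S\<close> near time 0. Its difference quotients
  then lie in the closed subspace \<open>S\<close>, hence so does their limit.\<close>

lemma chart_tangent_in:
  assumes x: "x \<in> U" and v: "v \<in> tangent_space M x"
  shows "D\<phi> x v \<in> S"
proof -
  obtain e c where e: "e > 0" and c: "c ` {-e<..<e} \<subseteq> M" "c 0 = x"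
    and c': "(c has_vector_derivative v) (at (0::real))"
    using v by (auto simp: tangent_space_def)
  have "(\<phi> has_derivative D\<phi> x) (at (c 0))"
    using smooth_on_has_derivative[OF smooth(1) x] c by simp
  with c' have "((\<lambda>t. \<phi> (c t)) has_derivative (\<lambda>t. D\<phi> x (t *\<^sub>R v))) (at 0)"
    unfolding has_vector_derivative_def by (rule has_derivative_compose)
  moreover have "D\<phi> x (t *\<^sub>R v) = t *\<^sub>R D\<phi> x v" for t
    using has_derivative_linear[OF smooth_on_has_derivative[OF smooth(1) x]] by (rule linear_cmul)
  ultimately have "((\<lambda>t. \<phi> (c t)) has_vector_derivative D\<phi> x v) (at 0)"
    by (simp add: has_vector_derivative_def)
  \<comment> \<open>Only positive times are kept, so that \<open>norm t\<close> is \<open>t\<close>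
    and the remainder becomes an ordinary difference quotient.\<close>
  then have "((\<lambda>t. \<phi> (c t)) has_derivative (\<lambda>t. t *\<^sub>R D\<phi> x v)) (at 0 within {0<..})"
    by (simp add: has_vector_derivative_def has_derivative_at_withinI)
  then have "((\<lambda>t. (1 / norm (t - 0)) *\<^sub>R (\<phi> (c t) - (\<phi> (c 0) + (t - 0) *\<^sub>R D\<phi> x v)))
      \<longlongrightarrow> 0) (at_right 0)"
    by (simp add: has_derivative_within)
  moreover have "eventually (\<lambda>t. (1 / norm (t - 0)) *\<^sub>R (\<phi> (c t) - (\<phi> (c 0) + (t - 0) *\<^sub>R D\<phi> x v))
      = (1 / t) *\<^sub>R (\<phi> (c t) - \<phi> (c 0)) - D\<phi> x v) (at_right 0)"
    using eventually_at_right_less[of 0]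
    by eventually_elim (simp add: algebra_simps)
  ultimately have "((\<lambda>t. (1 / t) *\<^sub>R (\<phi> (c t) - \<phi> (c 0)) - D\<phi> x v) \<longlongrightarrow> 0) (at_right 0)"
    by (rule Lim_transform_eventually)
  then have lim: "((\<lambda>t. (1 / t) *\<^sub>R (\<phi> (c t) - \<phi> (c 0))) \<longlongrightarrow> D\<phi> x v) (at_right 0)"
    by (rule Lim_null[THEN iffD2])
  have "(c \<longlongrightarrow> x) (at_right 0)"
    using has_vector_derivative_continuous[OF c'] c(2)
    by (auto simp: continuous_within intro: filterlim_mono at_le)
  then have "eventually (\<lambda>t. c t \<in> U) (at_right 0)"
    using open_UV(1) x by (rule topological_tendstoD)
  moreover have "eventually (\<lambda>t. t \<in> {-e<..<e}) (at_right 0)"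
    using e by (intro eventually_at_rightI[of 0 e]) auto
  ultimately have "eventually (\<lambda>t. (1 / t) *\<^sub>R (\<phi> (c t) - \<phi> (c 0)) \<in> S) (at_right 0)"
  proof eventually_elim
    case (elim t)
    then have "c t \<in> U \<inter> M" "c 0 \<in> U \<inter> M" using c x e by auto
    then have "\<phi> (c t) \<in> S" "\<phi> (c 0) \<in> S" using slice by blast+
    then show ?case using S by (intro subspace_scale subspace_diff)
  qed
  then show ?thesis
    using closed_subspace[OF S] lim by (intro Lim_in_closed_set) auto
qed

text \<open>The witness curve is the straight line through \<open>\<phi> x\<close> in direction
  \<open>w\<close>, which stays in \<open>S\<close>, pulled back by \<psi>.\<close>

lemma chart_tangent_image:
  assumes x: "x \<in> U \<inter> M" and w: "w \<in> S"
  shows "D\<psi> (\<phi> x) w \<in> tangent_space M x"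
proof -
  define c where "c t = \<psi> (\<phi> x + t *\<^sub>R w)" for t
  let ?W = "{t. \<phi> x + t *\<^sub>R w \<in> V}"
  have V: "\<phi> x \<in> V \<inter> S" and inv: "\<psi> (\<phi> x) = x"
    using homeo x slice by (auto simp: homeomorphism_def)
  have "open ?W"
    using open_vimage[OF open_UV(2), of "\<lambda>t. \<phi> x + t *\<^sub>R w"]
    by (simp add: vimage_def continuous_intros)
  then obtain e where e: "e > 0" "ball 0 e \<subseteq> ?W"
    using V open_contains_ball_eq[of ?W 0] by auto
  have ball: "ball 0 e = {-e<..<e}" by (auto simp: dist_real_def)
  have "Ck_on k ?W c" for k
    unfolding c_def using smooth(2) by (intro Ck_on_compose_line) (auto simp: smooth_on_def)
  then have "smooth_on {-e<..<e} c"
    using e(2) by (auto simp: smooth_on_def ball intro: Ck_on_subset)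
  moreover have "c ` {-e<..<e} \<subseteq> M"
  proof
    fix y assume "y \<in> c ` {-e<..<e}"
    then obtain t where t: "t \<in> ?W" "y = c t" using e(2) ball by auto
    have "\<phi> x + t *\<^sub>R w \<in> S" using V w S by (auto intro: subspace_add subspace_scale)
    with t(1) obtain z where "z \<in> U \<inter> M" "\<phi> z = \<phi> x + t *\<^sub>R w"
      using slice by (metis (mono_tags, lifting) IntI imageE mem_Collect_eq)
    then show "y \<in> M" using homeo t by (auto simp: c_def homeomorphism_def)
  qed
  moreover have "c 0 = x" by (simp add: c_def inv)
  moreover have "(c has_vector_derivative D\<psi> (\<phi> x) w) (at 0)"
  proof -
    have d: "(\<psi> has_derivative D\<psi> (\<phi> x)) (at (\<phi> x + 0 *\<^sub>R w))"
      using smooth_on_has_derivative[OF smooth(2)] V by simp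
    have "((\<lambda>t. \<phi> x + t *\<^sub>R w) has_derivative (\<lambda>t. t *\<^sub>R w)) (at 0)"
      by (auto intro!: derivative_eq_intros)
    from has_derivative_compose[OF this d]
    have "(c has_derivative (\<lambda>t. D\<psi> (\<phi> x) (t *\<^sub>R w))) (at 0)" by (simp add: c_def[abs_def])
    moreover have "D\<psi> (\<phi> x) (t *\<^sub>R w) = t *\<^sub>R D\<psi> (\<phi> x) w" for t
      using has_derivative_linear[OF d] by (rule linear_cmul)
    ultimately show ?thesis by (simp add: has_vector_derivative_def)
  qed
  ultimately show ?thesis using e(1) unfolding tangent_space_def by blast
qed

lemma tangent_space_chart:
  assumes "x \<in> U \<inter> M"
  shows "tangent_space M x = {v. D\<phi> x v \<in> S}"
  using assms chart_tangent_in[of x] chart_tangent_image[of x] chart_inverse[of x]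
  by (metis (no_types, lifting) Collect_eqI IntD1 mem_Collect_eq Collect_mem_eq)

end

section \<open>Linear structure and continuity of the tangent spaces\<close>

lemma embedded_submanifold_chart:
  assumes "embedded_submanifold d M" "p \<in> M"
  obtains U V \<phi> \<psi> S where "slice_chart M U V \<phi> \<psi> S" "p \<in> U"
  using assms unfolding embedded_submanifold_def slice_chart_def by meson

text \<open>A set of curve velocities is not visibly closed under addition. As the preimage of
  \<open>S\<close> under a linear map it is.\<close>

lemma subspace_tangent_space:
  assumes "embedded_submanifold d M" "x \<in> M"
  shows "subspace (tangent_space M x)"
proof -
  obtain U V \<phi> \<psi> S where "slice_chart M U V \<phi> \<psi> S" and x: "x \<in> U"
    using embedded_submanifold_chart[OF assms] .
  then interpret slice_chart M U V \<phi> \<psi> S by simp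
  have "subspace (D\<phi> x -` S)"
    using has_derivative_linear[OF smooth_on_has_derivative[OF smooth(1) x]] S
    by (rule linear_subspace_vimage)
  then show ?thesis using x assms by (simp add: tangent_space_chart vimage_def)
qed

text \<open>First half of the continuity of tangent spaces: limits of tangent vectors at converging
  base points are tangent. It makes limits of minimisers feasible.\<close>

lemma tangent_space_closed:
  assumes M: "embedded_submanifold d M" and x: "x \<in> M" "\<And>n. X n \<in> M" "X \<longlonglongrightarrow> x"
    and v: "\<And>n. v n \<in> tangent_space M (X n)" "v \<longlonglongrightarrow> w"
  shows "w \<in> tangent_space M x"
proof -
  obtain U V \<phi> \<psi> S where "slice_chart M U V \<phi> \<psi> S" and xU: "x \<in> U"
    using embedded_submanifold_chart[OF M x(1)] .
  then interpret slice_chart M U V \<phi> \<psi> S by simp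
  have "(\<lambda>n. D\<phi> (X n) (v n)) \<longlonglongrightarrow> D\<phi> x w"
    using smooth(1) xU x(3) v(2) by (rule smooth_on_tendsto_frechet_derivative)
  moreover have "eventually (\<lambda>n. X n \<in> U) sequentially"
    using xU x(3) open_UV by (auto dest: topological_tendstoD)
  then have "eventually (\<lambda>n. D\<phi> (X n) (v n) \<in> S) sequentially"
    by eventually_elim (use v chart_tangent_in in blast)
  ultimately have "D\<phi> x w \<in> S"
    using closed_subspace[OF S] by (intro Lim_in_closed_set) auto
  then show ?thesis using xU x(1) by (simp add: tangent_space_chart)
qed

text \<open>Second half: each tangent vector at the limit is reached from tangent vectors along the
  sequence. It makes every competitor at the limit available nearby.\<close>

lemma tangent_space_approx:
  assumes M: "embedded_submanifold d M" and x: "x \<in> M" "\<And>n. X n \<in> M" "X \<longlonglongrightarrow> x"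
    and w: "w \<in> tangent_space M x"
  obtains v where "\<And>n. v n \<in> tangent_space M (X n)" "v \<longlonglongrightarrow> w"
proof -
  obtain U V \<phi> \<psi> S where "slice_chart M U V \<phi> \<psi> S" and xU: "x \<in> U"
    using embedded_submanifold_chart[OF M x(1)] .
  then interpret slice_chart M U V \<phi> \<psi> S by simp
  \<comment> \<open>The vector is moved in the chart from \<open>x\<close> to \<open>X n\<close>.
    The value 0 serves the finitely many \<open>n\<close> with \<open>X n\<close> outside the chart
    and keeps \<open>v n\<close> tangent there.\<close>
  define v where "v n = (if X n \<in> U then D\<psi> (\<phi> (X n)) (D\<phi> x w) else 0)" for n
  have "v n \<in> tangent_space M (X n)" for n
    using x(2) chart_tangent_in[OF xU w] chart_tangent_image[of "X n" "D\<phi> x w"]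
      subspace_0[OF subspace_tangent_space[OF M x(2)]]
    by (auto simp: v_def)
  moreover have "v \<longlonglongrightarrow> w"
  proof -
    have "isCont \<phi> x" using smooth_on_has_derivative[OF smooth(1) xU] by (rule has_derivative_continuous)
    then have "(\<lambda>n. \<phi> (X n)) \<longlonglongrightarrow> \<phi> x" using x(3) by (rule isCont_tendsto_compose)
    moreover have "\<phi> x \<in> V" using homeo xU by (auto simp: homeomorphism_def)
    ultimately have "(\<lambda>n. D\<psi> (\<phi> (X n)) (D\<phi> x w)) \<longlonglongrightarrow> D\<psi> (\<phi> x) (D\<phi> x w)"
      by (intro smooth_on_tendsto_frechet_derivative[OF smooth(2)] tendsto_const)
    then have "(\<lambda>n. D\<psi> (\<phi> (X n)) (D\<phi> x w)) \<longlonglongrightarrow> w" using chart_inverse[OF xU] by simp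
    moreover have "eventually (\<lambda>n. X n \<in> U) sequentially"
      using xU x(3) open_UV by (auto dest: topological_tendstoD)
    then have "eventually (\<lambda>n. D\<psi> (\<phi> (X n)) (D\<phi> x w) = v n) sequentially"
      by eventually_elim (simp add: v_def)
    ultimately show ?thesis by (rule Lim_transform_eventually)
  qed
  ultimately show ?thesis by (rule that)
qed

text \<open>Smoothness on the bundle means local agreement with a smooth ambient map, whose
  continuity is inherited by restriction.\<close>

lemma continuous_on_retraction:
  assumes "retraction_on_manifold M Retr"
  shows "continuous_on (tangent_bundle M) Retr"
proof (rule continuous_on_eq_continuous_within[THEN iffD2, rule_format])
  fix p assume p: "p \<in> tangent_bundle M"
  with assms obtain W F where W: "p \<in> W" "smooth_on W F"
    and eq: "\<And>q. q \<in> W \<inter> tangent_bundle M \<Longrightarrow> F q = Retr q"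
    unfolding retraction_on_manifold_def smooth_on_subset_def by blast
  have "continuous (at p within tangent_bundle M) F"
    using smooth_on_has_derivative[OF W(2,1)] has_derivative_continuous continuous_at_imp_continuous_at_within
    by blast
  then have lim: "(F \<longlongrightarrow> Retr p) (at p within tangent_bundle M)"
    using eq p W(1) by (simp add: continuous_within)
  have "open W" using W(2) by (simp add: smooth_on_def)
  with W(1) have "eventually (\<lambda>q. q \<in> W) (at p within tangent_bundle M)"
    by (auto simp: eventually_at_topological)
  then have "eventually (\<lambda>q. F q = Retr q) (at p within tangent_bundle M)"
    using eventually_at_filter by (auto elim: eventually_mono simp: eventually_at_filter eq)
  with lim show "continuous (at p within tangent_bundle M) Retr"
    unfolding continuous_within by (rule Lim_transform_eventually)
qed

section \<open>Continuity of the direction and one step of the method\<close>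

context bregman_model
begin

text \<open>A maximum-theorem argument for a constraint set that varies with \<open>x\<close>: a map
  with closed graph and values in a compact set is continuous.\<close>

lemma continuous_on_bregman_direction:
  assumes "compact M" and M: "embedded_submanifold d M"
  shows "continuous_on (UNIV \<times> M) (\<lambda>(u, x). bregman_direction M h g \<gamma> u x)"
proof -
  let ?z = "\<lambda>(u, x). bregman_direction M h g \<gamma> u x"
  note sub = subspace_tangent_space[OF M]
  \<comment> \<open>Bounding \<open>u\<close> confines the minimisers to one compact ball, as the
    closed-graph criterion requires.\<close>
  have local: "continuous_on (cball 0 r \<times> M) ?z" for r
  proof (rule continuous_from_closed_graph)
    show "compact (cball (0 :: 'a) (2 * (r + L\<^sub>g) / (\<gamma> * \<mu>)))" by simp
    show "?z \<in> cball 0 r \<times> M \<rightarrow> cball 0 (2 * (r + L\<^sub>g) / (\<gamma> * \<mu>))"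
    proof safe
      fix u x :: 'a assume "u \<in> cball 0 r" "x \<in> M"
      have "norm (bregman_direction M h g \<gamma> u x) \<le> 2 * (norm u + L\<^sub>g) / (\<gamma> * \<mu>)"
        using \<open>x \<in> M\<close> by (intro bregman_direction_norm sub)
      also have "\<dots> \<le> 2 * (r + L\<^sub>g) / (\<gamma> * \<mu>)"
        using \<open>u \<in> cball 0 r\<close> gamma_mu_pos by (intro divide_right_mono) auto
      finally show "bregman_direction M h g \<gamma> u x \<in> cball 0 (2 * (r + L\<^sub>g) / (\<gamma> * \<mu>))" by simp
    qed
    show "closed ((\<lambda>p. (p, ?z p)) ` (cball 0 r \<times> M))"
    proof (unfold closed_sequential_limits, intro allI impI, elim conjE)
      fix q l assume q: "\<forall>n. q n \<in> (\<lambda>p. (p, ?z p)) ` (cball 0 r \<times> M)" and lim: "q \<longlonglongrightarrow> l"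
      define u x z where "u n = fst (fst (q n))" and "x n = snd (fst (q n))" and "z n = snd (q n)" for n
      obtain u' x' z' where l: "l = ((u', x'), z')" by (cases l) auto
      have lims: "u \<longlonglongrightarrow> u'" "x \<longlonglongrightarrow> x'" "z \<longlonglongrightarrow> z'"
        using tendsto_fst[OF tendsto_fst[OF lim]] tendsto_snd[OF tendsto_fst[OF lim]] tendsto_snd[OF lim]
        by (simp_all add: u_def[abs_def] x_def[abs_def] z_def[abs_def] l)
      have mem: "u n \<in> cball 0 r" "x n \<in> M" "z n = bregman_direction M h g \<gamma> (u n) (x n)" for n
        using q[rule_format, of n] by (auto simp: u_def x_def z_def)
      have x': "x' \<in> M"
        using closed_sequentially[OF compact_imp_closed[OF \<open>compact M\<close>]] mem(2) lims(2) by blast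
      have u': "u' \<in> cball 0 r"
        using closed_sequentially[OF closed_cball] mem(1) lims(1) by blast
      have "z' \<in> tangent_space M x'"
        by (rule tangent_space_closed[OF M x' mem(2) lims(2) _ lims(3)])
           (unfold mem(3), rule bregman_direction_in[OF sub[OF mem(2)]])
      \<comment> \<open>The limit is optimal: approximate \<open>w\<close> by vectors feasible along
        the sequence and pass to the limit in the optimality of \<open>z n\<close>. Uniqueness then
        identifies \<open>z'\<close>.\<close>
      moreover have "model u' x' z' \<le> model u' x' w" if w: "w \<in> tangent_space M x'" for w
      proof -
        obtain v where v: "\<And>n. v n \<in> tangent_space M (x n)" "v \<longlonglongrightarrow> w"
          using tangent_space_approx[OF M x' mem(2) lims(2) w] by blast
        have cont: "continuous_on UNIV (\<lambda>p. model (fst p) (fst (snd p)) (snd (snd p)))"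
          by (intro continuous_model continuous_intros)
        have "(\<lambda>n. model (u n) (x n) (y n)) \<longlonglongrightarrow> model u' x' y'" if "y \<longlonglongrightarrow> y'" for y y'
          using continuous_on_tendsto_compose[OF cont tendsto_Pair[OF lims(1) tendsto_Pair[OF lims(2) that]]]
          by simp
        from this[OF lims(3)] this[OF v(2)] show ?thesis
        proof (rule LIMSEQ_le, intro exI allI impI)
          show "model (u n) (x n) (z n) \<le> model (u n) (x n) (v n)" for n
            unfolding mem(3) by (rule bregman_direction_le[OF sub[OF mem(2)] v(1)])
        qed
      qed
      ultimately have "bregman_direction M h g \<gamma> u' x' = z'"
        using sub[OF x'] by (intro bregman_direction_unique) auto
      then have "l = ((u', x'), ?z (u', x'))" by (simp add: l)
      then show "l \<in> (\<lambda>p. (p, ?z p)) ` (cball 0 r \<times> M)" using u' x' by blast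
    qed
  qed
  show ?thesis
  proof (rule continuous_on_sequentially[THEN iffD2], intro allI ballI impI, elim conjE)
    fix p :: "nat \<Rightarrow> 'a \<times> 'a" and l
    assume l: "l \<in> UNIV \<times> M" and p: "\<forall>n. p n \<in> UNIV \<times> M" "p \<longlonglongrightarrow> l"
    \<comment> \<open>A convergent sequence is bounded, so one of the local statements covers the
      sequence and its limit.\<close>
    obtain r where r: "norm (p n) \<le> r" for n
      using convergent_imp_bounded[OF p(2)] by (auto simp: bounded_iff)
    have "p n \<in> cball 0 r \<times> M" for n
      using order_trans[OF norm_fst_le[of "fst (p n)" "snd (p n)", unfolded prod.collapse] r[of n]] p(1)[rule_format, of n] by (simp add: mem_Times_iff)
    moreover have "norm l \<le> r"
      using tendsto_norm[OF p(2)] r by (intro LIMSEQ_le_const2) auto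
    then have "l \<in> cball 0 r \<times> M"
      using order_trans[OF norm_fst_le[of "fst l" "snd l", unfolded prod.collapse]] l by (simp add: mem_Times_iff)
    ultimately show "(?z \<circ> p) \<longlonglongrightarrow> ?z l"
      using local[of r] p(2) unfolding continuous_on_sequentially by blast
  qed
qed

end

section \<open>Decrease of the objective in one step\<close>

locale retraction_method = bregman_model h g \<gamma> \<mu> L\<^sub>g
  for h g :: "'a::euclidean_space \<Rightarrow> real" and \<gamma> \<mu> L\<^sub>g :: real +
  fixes M :: "'a set" and d :: nat and Retr :: "'a \<times> 'a \<Rightarrow> 'a" and f :: "'a \<Rightarrow> real"
    and L M2 G\<^sub>f G\<^sub>h \<alpha> :: real
  assumes compact_M: "compact M" and submanifold_M: "embedded_submanifold d M"
    and retraction: "retraction_on_manifold M Retr"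
    and M2_pos: "M2 > 0"
    and Retr_second_order:
      "\<And>x v. x \<in> M \<Longrightarrow> v \<in> tangent_space M x \<Longrightarrow> norm (Retr (x, v) - (x + v)) \<le> M2 * (norm v)\<^sup>2"
    and f_diff: "continuously_differentiable f"
    and f_rel_smooth: "relatively_smooth L h f" and L_le: "L \<le> \<gamma>"
    and G\<^sub>f: "\<And>x. x \<in> M \<Longrightarrow> norm (grad f x) \<le> G\<^sub>f"
    and G\<^sub>h: "\<And>x. x \<in> M \<Longrightarrow> norm (grad h x) \<le> G\<^sub>h"
    and alpha_pos: "0 < \<alpha>"
    and alpha_less: "\<alpha> < \<gamma> * \<mu> / (8 * (G\<^sub>f + 2 * \<gamma> * G\<^sub>h + L\<^sub>g) * M2)"
begin

lemma subspace_T: "x \<in> M \<Longrightarrow> subspace (tangent_space M x)"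
  by (rule subspace_tangent_space[OF submanifold_M])

lemma Retr_in: "x \<in> M \<Longrightarrow> v \<in> tangent_space M x \<Longrightarrow> Retr (x, v) \<in> M"
  using retraction unfolding retraction_on_manifold_def tangent_bundle_def by blast

text \<open>Strong convexity makes \<open>grad h\<close> strongly monotone, so \<open>M\<close> has diameter at most
  \<open>2 * G\<^sub>h / \<mu>\<close>. A tangent vector of length \<open>1 / (2 * M2)\<close> is however moved by the retraction to a
  point at distance at least \<open>1 / (4 * M2)\<close>.\<close>

lemma mu_le:
  assumes x: "x \<in> M" and v: "v \<in> tangent_space M x" "v \<noteq> 0"
  shows "\<mu> \<le> 8 * G\<^sub>h * M2"
proof -
  define w where "w = (1 / (2 * M2 * norm v)) *\<^sub>R v"
  have w: "w \<in> tangent_space M x" unfolding w_def using v subspace_T[OF x] by (intro subspace_scale)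
  have nw: "norm w = 1 / (2 * M2)" using v M2_pos by (simp add: w_def)
  define y where "y = Retr (x, w)"
  have y: "y \<in> M" unfolding y_def using x w by (rule Retr_in)
  have "norm w - norm (y - x) \<le> norm (y - (x + w))"
    using norm_triangle_ineq2[of w "y - x"] by (simp add: norm_minus_commute algebra_simps)
  also have "\<dots> \<le> M2 * (norm w)\<^sup>2" unfolding y_def using x w by (rule Retr_second_order)
  finally have dist: "1 / (4 * M2) \<le> norm (y - x)"
    using M2_pos by (simp add: nw power2_eq_square field_simps)
  moreover have "0 < 1 / (4 * M2)" using M2_pos by simp
  ultimately have pos: "0 < norm (y - x)" by linarith
  have "\<mu> * (norm (y - x))\<^sup>2 \<le> (grad h y - grad h x) \<bullet> (y - x)"
    using strongly_convex_first_order[OF h_sc h_differentiable, of x y]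
      strongly_convex_first_order[OF h_sc h_differentiable, of y x]
    by (simp add: norm_minus_commute inner_diff_left inner_diff_right)
  also have "\<dots> \<le> norm (grad h y - grad h x) * norm (y - x)" by (rule norm_cauchy_schwarz)
  also have "\<dots> \<le> (2 * G\<^sub>h) * norm (y - x)"
    using norm_triangle_ineq4[of "grad h y" "grad h x"] G\<^sub>h[OF x] G\<^sub>h[OF y] by (intro mult_right_mono) auto
  finally have "\<mu> * norm (y - x) \<le> 2 * G\<^sub>h" using pos by (simp add: power2_eq_square)
  moreover have "\<mu> * (1 / (4 * M2)) \<le> \<mu> * norm (y - x)"
    using dist mu_pos by (intro mult_left_mono) auto
  ultimately have "\<mu> * (1 / (4 * M2)) \<le> 2 * G\<^sub>h" by linarith
  then show ?thesis using M2_pos by (simp add: field_simps)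
qed

text \<open>Two uses of the bound on \<alpha>: the first part absorbs the retraction error, the
  second makes \<open>x + \<alpha> *\<^sub>R \<zeta>\<close> a convex combination of
  \<open>x\<close> and \<open>x + \<zeta>\<close>.\<close>

lemma
  assumes "x \<in> M"
  shows step_bound: "\<alpha> * (G\<^sub>f + 2 * \<gamma> * G\<^sub>h + L\<^sub>g) * M2 \<le> \<gamma> * \<mu> / 8"
    and alpha_le_1: "v \<in> tangent_space M x \<Longrightarrow> v \<noteq> 0 \<Longrightarrow> \<alpha> \<le> 1"
proof -
  let ?K = "G\<^sub>f + 2 * \<gamma> * G\<^sub>h + L\<^sub>g"
  have G: "0 \<le> G\<^sub>f" "0 \<le> G\<^sub>h" using order_trans[OF norm_ge_zero G\<^sub>f[OF assms]] order_trans[OF norm_ge_zero G\<^sub>h[OF assms]] by auto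
  have K0: "0 \<le> ?K" using G gamma_pos Lg_nonneg by simp
  \<comment> \<open>Division by zero yields 0 in HOL, so \<open>?K = 0\<close> would turn
    \<open>alpha_less\<close> into \<open>\<alpha> < 0\<close>.\<close>
  have "?K \<noteq> 0"
  proof
    assume "?K = 0"
    then show False using alpha_pos alpha_less by (simp only: mult_zero_right mult_zero_left div_by_0)
  qed
  with K0 have K: "0 < ?K" by simp
  have "\<alpha> * (8 * ?K * M2) < \<gamma> * \<mu>"
    using alpha_less K M2_pos by (simp add: pos_less_divide_eq)
  then show *: "\<alpha> * ?K * M2 \<le> \<gamma> * \<mu> / 8" by (simp add: algebra_simps)
  assume "v \<in> tangent_space M x" "v \<noteq> 0"
  then have "\<gamma> * \<mu> \<le> \<gamma> * (8 * G\<^sub>h * M2)"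
    using gamma_pos by (intro mult_left_mono mu_le[OF assms]) auto
  also have "\<dots> \<le> 8 * ?K * M2"
    using G gamma_pos Lg_nonneg M2_pos by (simp add: algebra_simps)
  finally have "\<alpha> * (\<gamma> * \<mu>) \<le> \<alpha> * (8 * ?K * M2)" using alpha_pos by simp
  also have "\<dots> \<le> 1 * (\<gamma> * \<mu>)" using * by (simp add: algebra_simps)
  finally show "\<alpha> \<le> 1" by (simp only: mult_le_cancel_right_pos[OF gamma_mu_pos])
qed

text \<open>The new point differs from \<open>x + \<alpha> \<zeta>\<close> by \<open>r\<close> with \<open>\<parallel>r\<parallel> \<le> M2 \<alpha>\<^sup>2 \<parallel>\<zeta>\<parallel>\<^sup>2\<close>. Convexity of
  \<open>h\<close> is used at the new point, which lies in \<open>M\<close>, to bound the Bregman distance by \<open>G\<^sub>h\<close>.\<close>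

lemma retraction_decrease:
  assumes x: "x \<in> M" and z: "\<zeta> \<in> tangent_space M x"
  defines "y \<equiv> Retr (x, \<alpha> *\<^sub>R \<zeta>)"
  shows "f y + g y - (f x + g x)
    \<le> \<alpha> * (model (grad f x) x \<zeta> - g x) + \<alpha> * (\<gamma> * \<mu> / 8) * (norm \<zeta>)\<^sup>2"
\<comment> \<open>A zero direction is treated apart because \<open>alpha_le_1\<close> requires a
  nonzero tangent vector.\<close>
proof (cases "\<zeta> = 0")
  case True
  have "y = x" using retraction x by (simp add: y_def True retraction_on_manifold_def)
  then show ?thesis using True by (simp add: model_zero)
next
  case False
  have a1: "\<alpha> \<le> 1" using x z False by (rule alpha_le_1)
  have az: "\<alpha> *\<^sub>R \<zeta> \<in> tangent_space M x" using z subspace_T[OF x] by (intro subspace_scale)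
  have y: "y \<in> M" unfolding y_def using x az by (rule Retr_in)
  define r where "r = y - (x + \<alpha> *\<^sub>R \<zeta>)"
  have r: "norm r \<le> M2 * (\<alpha>\<^sup>2 * (norm \<zeta>)\<^sup>2)"
    using Retr_second_order[OF x az] alpha_pos by (simp add: r_def y_def power_mult_distrib)
  have y_eq: "y = x + \<alpha> *\<^sub>R \<zeta> + r" by (simp add: r_def)
  let ?p = "x + \<alpha> *\<^sub>R \<zeta>"
  have p_eq: "?p = (1 - \<alpha>) *\<^sub>R x + \<alpha> *\<^sub>R (x + \<zeta>)" by (simp add: algebra_simps)
  have hp: "h ?p \<le> (1 - \<alpha>) * h x + \<alpha> * h (x + \<zeta>)"
  proof -
    have "h ((1 - \<alpha>) *\<^sub>R x + \<alpha> *\<^sub>R (x + \<zeta>)) \<le> (1 - \<alpha>) * h x + \<alpha> * h (x + \<zeta>)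
        - \<mu> / 2 * \<alpha> * (1 - \<alpha>) * (norm (x - (x + \<zeta>)))\<^sup>2"
      using h_sc[unfolded strongly_convex_def, rule_format, of \<alpha> x "x + \<zeta>"] a1 alpha_pos by simp
    moreover have "0 \<le> \<mu> / 2 * \<alpha> * (1 - \<alpha>) * (norm (x - (x + \<zeta>)))\<^sup>2"
      using mu_pos a1 alpha_pos by simp
    ultimately show ?thesis unfolding p_eq by linarith
  qed
  have hy: "h y + grad h y \<bullet> (?p - y) \<le> h ?p"
  proof -
    have "0 \<le> \<mu> / 2 * (norm (?p - y))\<^sup>2" using mu_pos by simp
    then show ?thesis using strongly_convex_first_order[OF h_sc h_differentiable, of y ?p] by linarith
  qed
  have ip: "\<bar>grad k q \<bullet> r\<bar> \<le> G * norm r" if "norm (grad k q) \<le> G" for k q G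
    using Cauchy_Schwarz_ineq2[of "grad k q" r] mult_right_mono[OF that norm_ge_zero[of r]] by linarith
  \<comment> \<open>The factor 2 collects two errors in \<open>r\<close>: one through
    \<open>grad h y\<close> from convexity at \<open>y\<close>, one through \<open>grad h x\<close>
    from the linear part of the Bregman distance.\<close>
  have "bregman h y x \<le> \<alpha> * bregman h (x + \<zeta>) x + 2 * G\<^sub>h * norm r"
    using hy hp ip[OF G\<^sub>h[OF y]] ip[OF G\<^sub>h[OF x]]
    by (simp add: bregman_def y_eq inner_add_right algebra_simps)
  from mult_left_mono[OF this less_imp_le[OF gamma_pos]]
  have D: "\<gamma> * bregman h y x \<le> \<alpha> * (\<gamma> * bregman h (x + \<zeta>) x) + 2 * \<gamma> * G\<^sub>h * norm r"
    by (simp add: algebra_simps)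
  have "f y \<le> f x + grad f x \<bullet> (y - x) + L * bregman h y x"
    using f_rel_smooth by (simp add: relatively_smooth_def)
  also have "\<dots> \<le> f x + grad f x \<bullet> (y - x) + \<gamma> * bregman h y x"
    using L_le bregman_nonneg by (simp add: mult_right_mono)
  also have "grad f x \<bullet> (y - x) \<le> \<alpha> * (grad f x \<bullet> \<zeta>) + G\<^sub>f * norm r"
    using ip[OF G\<^sub>f[OF x]] by (simp add: y_eq inner_add_right)
  finally have F: "f y \<le> f x + (\<alpha> * (grad f x \<bullet> \<zeta>) + G\<^sub>f * norm r) + \<gamma> * bregman h y x" by simp
  have gp: "g ?p \<le> (1 - \<alpha>) * g x + \<alpha> * g (x + \<zeta>)"
    unfolding p_eq using g_convex a1 alpha_pos by (auto simp: convex_on_def)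
  have gy: "g y \<le> g ?p + L\<^sub>g * norm r" using g_diff_le[of y ?p] by (simp add: y_eq)
  have "f y + g y - (f x + g x)
      \<le> \<alpha> * (model (grad f x) x \<zeta> - g x) + (G\<^sub>f + 2 * \<gamma> * G\<^sub>h + L\<^sub>g) * norm r"
    using F D gp gy by (simp add: model_def algebra_simps)
  also have "(G\<^sub>f + 2 * \<gamma> * G\<^sub>h + L\<^sub>g) * norm r \<le> (G\<^sub>f + 2 * \<gamma> * G\<^sub>h + L\<^sub>g) * (M2 * (\<alpha>\<^sup>2 * (norm \<zeta>)\<^sup>2))"
  proof (rule mult_left_mono[OF r])
    have "0 \<le> G\<^sub>f" "0 \<le> G\<^sub>h" 
      using order_trans[OF norm_ge_zero G\<^sub>f[OF x]] order_trans[OF norm_ge_zero G\<^sub>h[OF x]] by auto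
    then show "0 \<le> G\<^sub>f + 2 * \<gamma> * G\<^sub>h + L\<^sub>g" using gamma_pos Lg_nonneg by simp
  qed
  \<comment> \<open>One of the two factors \<alpha> is grouped with the constants so that
    \<open>step_bound\<close> applies. The other matches the factor of the model term.\<close>
  also have "\<dots> = \<alpha> * (\<alpha> * (G\<^sub>f + 2 * \<gamma> * G\<^sub>h + L\<^sub>g) * M2) * (norm \<zeta>)\<^sup>2"
    by (simp add: power2_eq_square algebra_simps)
  also have "\<dots> \<le> \<alpha> * (\<gamma> * \<mu> / 8) * (norm \<zeta>)\<^sup>2"
    using step_bound[OF x] alpha_pos by (intro mult_right_mono mult_left_mono) auto
  finally show ?thesis by simp
qed

text \<open>The descent estimate controls the direction for \<open>u\<close>, and the Lipschitz
  bound passes to the exact gradient. Squaring the triangle inequality doubles both parts: 16 is 2 *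
  8, and 18 is 2 + 2 * 8.\<close>

lemma one_step:
  assumes x: "x \<in> M"
  defines "\<zeta> \<equiv> \<lambda>u. bregman_direction M h g \<gamma> u x"
  defines "y \<equiv> \<lambda>u. Retr (x, \<alpha> *\<^sub>R \<zeta> u)"
  shows "(norm (\<zeta> (grad f x)))\<^sup>2 \<le> 16 / (\<alpha> * (\<gamma> * \<mu>)) * (f x + g x - (f (y u) + g (y u)))
    + 18 / (\<gamma> * \<mu>)\<^sup>2 * (norm (u - grad f x))\<^sup>2"
proof -
  define c where "c = \<gamma> * \<mu>"
  have c: "0 < c" using gamma_mu_pos by (simp add: c_def)
  define \<delta> where "\<delta> = u - grad f x"
  have T: "\<zeta> u \<in> tangent_space M x" unfolding \<zeta>_def by (rule bregman_direction_in[OF subspace_T[OF x]])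
  have "model u x (\<zeta> u) + c / 2 * (norm (\<zeta> u))\<^sup>2 \<le> g x"
    using bregman_direction_strong[OF subspace_T[OF x] subspace_0[OF subspace_T[OF x]], of u]
    by (simp add: \<zeta>_def c_def model_zero)
  moreover have "model u x (\<zeta> u) = model (grad f x) x (\<zeta> u) + \<delta> \<bullet> \<zeta> u"
    by (simp add: model_def \<delta>_def inner_diff_left)
  \<comment> \<open>Young's inequality, weighted to use \<open>c / 4\<close> of the available
    \<open>c / 2\<close>. After the retraction error \<open>c / 8\<close>, a decrease with
    coefficient \<open>c / 8\<close> survives.\<close>
  moreover have "- (\<delta> \<bullet> \<zeta> u) \<le> (norm \<delta>)\<^sup>2 / c + c / 4 * (norm (\<zeta> u))\<^sup>2"
  proof -
    have "- (\<delta> \<bullet> \<zeta> u) \<le> norm \<delta> * norm (\<zeta> u)" using Cauchy_Schwarz_ineq2[of \<delta> "\<zeta> u"] by linarith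
    moreover have "0 \<le> (norm \<delta> - c / 2 * norm (\<zeta> u))\<^sup>2 / c" using c by simp
    then have "norm \<delta> * norm (\<zeta> u) \<le> (norm \<delta>)\<^sup>2 / c + c / 4 * (norm (\<zeta> u))\<^sup>2"
      using c by (simp add: power2_eq_square field_simps)
    ultimately show ?thesis by linarith
  qed
  ultimately have m: "model (grad f x) x (\<zeta> u) - g x \<le> (norm \<delta>)\<^sup>2 / c - c / 4 * (norm (\<zeta> u))\<^sup>2"
    by linarith
  have "f (y u) + g (y u) - (f x + g x)
      \<le> \<alpha> * (model (grad f x) x (\<zeta> u) - g x) + \<alpha> * (c / 8) * (norm (\<zeta> u))\<^sup>2"
    unfolding y_def c_def by (rule retraction_decrease[OF x T])
  also have "\<dots> \<le> \<alpha> * ((norm \<delta>)\<^sup>2 / c - c / 4 * (norm (\<zeta> u))\<^sup>2) + \<alpha> * (c / 8) * (norm (\<zeta> u))\<^sup>2"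
    using m alpha_pos by simp
  finally have "\<alpha> * c * (norm (\<zeta> u))\<^sup>2
      \<le> 8 * (f x + g x - (f (y u) + g (y u))) + 8 * (\<alpha> * ((norm \<delta>)\<^sup>2 / c))"
    unfolding right_diff_distrib by (simp add: mult.assoc)
  then have z: "(norm (\<zeta> u))\<^sup>2 \<le> 8 / (\<alpha> * c) * (f x + g x - (f (y u) + g (y u))) + 8 / c\<^sup>2 * (norm \<delta>)\<^sup>2"
    using alpha_pos c by (simp add: field_simps power2_eq_square)
  have "norm (\<zeta> (grad f x) - \<zeta> u) \<le> norm \<delta> / c"
    using bregman_direction_lipschitz[OF subspace_T[OF x], of "grad f x" u]
    by (simp add: \<zeta>_def c_def \<delta>_def norm_minus_commute)
  then have "(norm (\<zeta> (grad f x) - \<zeta> u))\<^sup>2 \<le> (norm \<delta> / c)\<^sup>2" by (rule power_mono) simp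
  moreover have "(norm (\<zeta> (grad f x)))\<^sup>2 \<le> 2 * (norm (\<zeta> (grad f x) - \<zeta> u))\<^sup>2 + 2 * (norm (\<zeta> u))\<^sup>2"
  proof -
    have "norm (\<zeta> (grad f x)) \<le> norm (\<zeta> (grad f x) - \<zeta> u) + norm (\<zeta> u)"
      using norm_triangle_sub[of "\<zeta> (grad f x)" "\<zeta> u"] by simp
    then have "(norm (\<zeta> (grad f x)))\<^sup>2 \<le> (norm (\<zeta> (grad f x) - \<zeta> u) + norm (\<zeta> u))\<^sup>2"
      by (rule power_mono) simp
    also have "\<dots> \<le> 2 * (norm (\<zeta> (grad f x) - \<zeta> u))\<^sup>2 + 2 * (norm (\<zeta> u))\<^sup>2"
      using sum_squares_bound[of "norm (\<zeta> (grad f x) - \<zeta> u)" "norm (\<zeta> u)"] by (simp add: power2_sum)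
    finally show ?thesis .
  qed
  ultimately have "(norm (\<zeta> (grad f x)))\<^sup>2 \<le> 2 * (norm \<delta> / c)\<^sup>2 + 2 * (norm (\<zeta> u))\<^sup>2"
    by linarith
  also have "\<dots> \<le> 2 * (norm \<delta> / c)\<^sup>2
      + 2 * (8 / (\<alpha> * c) * (f x + g x - (f (y u) + g (y u))) + 8 / c\<^sup>2 * (norm \<delta>)\<^sup>2)"
    using z by (intro add_left_mono mult_left_mono) auto
  finally have "(norm (\<zeta> (grad f x)))\<^sup>2 \<le> 2 * (norm \<delta> / c)\<^sup>2
      + 2 * (8 / (\<alpha> * c) * (f x + g x - (f (y u) + g (y u))) + 8 / c\<^sup>2 * (norm \<delta>)\<^sup>2)" .
  then show ?thesis by (simp add: c_def \<delta>_def power_divide algebra_simps)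
qed

end

section \<open>Measurability and independence\<close>

text \<open>Replace the first argument by simple functions converging to it. For each of them
  finitely many sections of \<open>k\<close> are involved, and continuity of \<open>k\<close>
  carries measurability to the limit.\<close>

lemma borel_measurable_caratheodory:
  fixes k :: "'a::euclidean_space \<Rightarrow> 'p \<Rightarrow> real"
  assumes meas: "\<And>x. k x \<in> borel_measurable P"
    and cont: "\<And>\<pi>. \<pi> \<in> space P \<Longrightarrow> continuous_on UNIV (\<lambda>x. k x \<pi>)"
  shows "(\<lambda>p. k (fst p) (snd p)) \<in> borel_measurable (borel \<Otimes>\<^sub>M P)"
proof -
  obtain F :: "nat \<Rightarrow> 'a \<Rightarrow> 'a" where F: "\<And>i. simple_function borel (F i)"
    and lim: "\<And>x. (\<lambda>i. F i x) \<longlonglongrightarrow> x"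
    using borel_measurable_implies_sequence_metric[of "\<lambda>x. x" "borel :: 'a measure" 0] by auto
  have "(\<lambda>p. k (F i (fst p)) (snd p)) \<in> borel_measurable (borel \<Otimes>\<^sub>M P)" for i
  proof (rule measurable_compose_countable'[where I = "range (F i)" and g = "\<lambda>p. F i (fst p)"
        and f = "\<lambda>z p. k z (snd p)"])
    show "countable (range (F i))"
      using F[of i] by (auto simp: simple_function_def intro: countable_finite)
    then have "F i \<in> measurable borel (count_space (range (F i)))"
      using simple_functionD(2)[OF F[of i]] by (subst measurable_count_space_eq_countable) auto
    then show "(\<lambda>p. F i (fst p)) \<in> measurable (borel \<Otimes>\<^sub>M P) (count_space (range (F i)))"
      by (rule measurable_compose[OF measurable_fst])
  qed (use meas in measurable)
  then show ?thesis
  proof (rule borel_measurable_LIMSEQ_metric)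
    fix p :: "'a \<times> 'p" assume "p \<in> space (borel \<Otimes>\<^sub>M P)"
    then have "snd p \<in> space P" by (auto simp: space_pair_measure)
    from continuous_on_tendsto_compose[OF cont[OF this] lim[of "fst p"]]
    show "(\<lambda>i. k (F i (fst p)) (snd p)) \<longlonglongrightarrow> k (fst p) (snd p)" by simp
  qed
qed

text \<open>Joint measurability in point and sample is needed because the oracle is evaluated at a
  random iterate. Each coordinate is a limit of difference quotients of step
  \<open>1 / (n + 1)\<close>, to which the previous lemma applies.\<close>

lemma borel_measurable_grad:
  fixes fs :: "'a::euclidean_space \<Rightarrow> 'p \<Rightarrow> real"
  assumes meas: "\<And>x. fs x \<in> borel_measurable P"
    and diff: "\<And>x \<pi>. \<pi> \<in> space P \<Longrightarrow> (\<lambda>y. fs y \<pi>) differentiable (at x)"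
  shows "(\<lambda>p. grad (\<lambda>y. fs y (snd p)) (fst p)) \<in> borel_measurable (borel \<Otimes>\<^sub>M P)"
proof (subst borel_measurable_euclidean_space, intro ballI)
  fix i :: 'a assume "i \<in> Basis"
  let ?s = "\<lambda>n. inverse (real (Suc n))"
  have cara: "(\<lambda>p. fs (fst p + c) (snd p)) \<in> borel_measurable (borel \<Otimes>\<^sub>M P)" for c
  proof (rule borel_measurable_caratheodory)
    fix \<pi> assume "\<pi> \<in> space P"
    then have "continuous_on UNIV (\<lambda>y. fs y \<pi>)"
      using diff by (intro continuous_at_imp_continuous_on ballI differentiable_imp_continuous_within)
    then show "continuous_on UNIV (\<lambda>x. fs (x + c) \<pi>)"
      by (rule continuous_on_compose2) (auto intro!: continuous_intros)
  qed (rule meas)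
  have "(\<lambda>p. (fs (fst p + ?s n *\<^sub>R i) (snd p) - fs (fst p) (snd p)) / ?s n)
      \<in> borel_measurable (borel \<Otimes>\<^sub>M P)" for n
    using cara[of 0] by (intro borel_measurable_divide borel_measurable_diff cara) simp_all
  then show "(\<lambda>p. grad (\<lambda>y. fs y (snd p)) (fst p) \<bullet> i) \<in> borel_measurable (borel \<Otimes>\<^sub>M P)"
  proof (rule borel_measurable_LIMSEQ_metric)
    fix p :: "'a \<times> 'p" assume "p \<in> space (borel \<Otimes>\<^sub>M P)"
    then have "snd p \<in> space P" by (auto simp: space_pair_measure)
    moreover have "filterlim ?s (at 0) sequentially"
      using LIMSEQ_inverse_real_of_nat by (auto simp: filterlim_at)
    ultimately show "(\<lambda>n. (fs (fst p + ?s n *\<^sub>R i) (snd p) - fs (fst p) (snd p)) / ?s n)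
        \<longlonglongrightarrow> grad (\<lambda>y. fs y (snd p)) (fst p) \<bullet> i"
      using filterlim_compose[OF difference_quotient_tendsto_grad[OF diff]]
      by (simp add: inner_commute)
  qed
qed

section \<open>Second moments of independent sums, and integration over an independent
  variable\<close>

context prob_space
begin

lemma
  fixes X :: "'i \<Rightarrow> 'a \<Rightarrow> 'b::euclidean_space"
  assumes fin: "finite I" and ind: "indep_vars (\<lambda>_. borel) X I"
    and int: "\<And>i. i \<in> I \<Longrightarrow> integrable M (X i)"
    and int2: "\<And>i. i \<in> I \<Longrightarrow> integrable M (\<lambda>\<omega>. (norm (X i \<omega>))\<^sup>2)"
    and mean: "\<And>i. i \<in> I \<Longrightarrow> expectation (X i) = 0"
  shows integrable_norm_sum_indep: "integrable M (\<lambda>\<omega>. (norm (\<Sum>i\<in>I. X i \<omega>))\<^sup>2)"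
    and expectation_norm_sum_indep:
      "expectation (\<lambda>\<omega>. (norm (\<Sum>i\<in>I. X i \<omega>))\<^sup>2) = (\<Sum>i\<in>I. expectation (\<lambda>\<omega>. (norm (X i \<omega>))\<^sup>2))"
proof -
  \<comment> \<open>In coordinates the inner product is a sum of products of independent centred
    variables, so mixed terms vanish in expectation.\<close>
  have cross: "integrable M (\<lambda>\<omega>. X i \<omega> \<bullet> X j \<omega>) \<and> expectation (\<lambda>\<omega>. X i \<omega> \<bullet> X j \<omega>) = 0"
    if ij: "i \<in> I" "j \<in> I" "i \<noteq> j" for i j
  proof -
    have "indep_var borel (X i) borel (X j)" 
      using indep_var_compose[OF indep_var_restrict[OF ind, of "{i}" "{j}"],
          of "\<lambda>y. y i" borel "\<lambda>y. y j" borel] ij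
      by (simp add: comp_def)
    then have comp: "indep_var borel (\<lambda>\<omega>. X i \<omega> \<bullet> b) borel (\<lambda>\<omega>. X j \<omega> \<bullet> b)" for b
      using indep_var_compose[of borel "X i" borel "X j" "\<lambda>x. x \<bullet> b" borel "\<lambda>x. x \<bullet> b" borel]
      by (simp add: comp_def)
    have "integrable M (\<lambda>\<omega>. (X i \<omega> \<bullet> b) * (X j \<omega> \<bullet> b))" for b
      using comp int ij by (intro indep_var_integrable) auto
    moreover have "expectation (\<lambda>\<omega>. (X i \<omega> \<bullet> b) * (X j \<omega> \<bullet> b)) = 0" for b
      using comp int ij by (subst indep_var_lebesgue_integral) (auto simp: mean)
    ultimately show ?thesis
      by (subst (1 2) euclidean_inner) simp
  qed
  have sq: "(norm (\<Sum>i\<in>I. X i \<omega>))\<^sup>2 = (\<Sum>i\<in>I. \<Sum>j\<in>I. X i \<omega> \<bullet> X j \<omega>)" for \<omega>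
    by (simp add: power2_norm_eq_inner inner_sum_left inner_sum_right inner_commute)
  have pair: "integrable M (\<lambda>\<omega>. X i \<omega> \<bullet> X j \<omega>)" if "i \<in> I" "j \<in> I" for i j
    using cross[of i j] int2[of i] that by (cases "i = j") (auto simp: power2_norm_eq_inner)
  then show "integrable M (\<lambda>\<omega>. (norm (\<Sum>i\<in>I. X i \<omega>))\<^sup>2)" unfolding sq by simp
  have "expectation (\<lambda>\<omega>. (norm (\<Sum>i\<in>I. X i \<omega>))\<^sup>2)
      = (\<Sum>i\<in>I. \<Sum>j\<in>I. expectation (\<lambda>\<omega>. X i \<omega> \<bullet> X j \<omega>))"
    unfolding sq using pair by simp
  also have "\<dots> = (\<Sum>i\<in>I. \<Sum>j\<in>I. if i = j then expectation (\<lambda>\<omega>. (norm (X i \<omega>))\<^sup>2) else 0)"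
    using cross by (intro sum.cong refl) (auto simp: power2_norm_eq_inner)
  finally show "expectation (\<lambda>\<omega>. (norm (\<Sum>i\<in>I. X i \<omega>))\<^sup>2)
      = (\<Sum>i\<in>I. expectation (\<lambda>\<omega>. (norm (X i \<omega>))\<^sup>2))"
    using fin by simp
qed

text \<open>Replaces conditioning on the past: the joint law is a product, so by Tonelli it suffices
  to bound the integral over \<open>Y\<close> for each frozen value of \<open>X\<close>. With
  nonnegative integrals no integrability has to be known beforehand.\<close>

lemma nn_integral_indep_var_le:
  assumes ind: "indep_var S X T Y"
    and meas: "(\<lambda>p. \<psi> (fst p) (snd p)) \<in> borel_measurable (S \<Otimes>\<^sub>M T)"
    and le: "\<And>x. x \<in> space S \<Longrightarrow> (\<integral>\<^sup>+\<omega>. \<psi> x (Y \<omega>) \<partial>M) \<le> c"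
  shows "(\<integral>\<^sup>+\<omega>. \<psi> (X \<omega>) (Y \<omega>) \<partial>M) \<le> c"
proof -
  have X: "random_variable S X" and Y: "random_variable T Y"
    and eq: "distr M S X \<Otimes>\<^sub>M distr M T Y = distr M (S \<Otimes>\<^sub>M T) (\<lambda>\<omega>. (X \<omega>, Y \<omega>))"
    using ind by (auto simp: indep_var_distribution_eq)
  interpret X: prob_space "distr M S X" using X by (rule prob_space_distr)
  interpret Y: prob_space "distr M T Y" using Y by (rule prob_space_distr)
  let ?\<psi> = "\<lambda>p. \<psi> (fst p) (snd p)"
  have "(\<integral>\<^sup>+\<omega>. \<psi> (X \<omega>) (Y \<omega>) \<partial>M) = (\<integral>\<^sup>+p. ?\<psi> p \<partial>distr M (S \<Otimes>\<^sub>M T) (\<lambda>\<omega>. (X \<omega>, Y \<omega>)))"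
    using X Y meas by (subst nn_integral_distr) auto
  also have "\<dots> = (\<integral>\<^sup>+x. \<integral>\<^sup>+y. \<psi> x y \<partial>distr M T Y \<partial>distr M S X)"
    using meas by (subst eq[symmetric], subst Y.nn_integral_fst[symmetric])
      (auto simp: measurable_cong_sets[OF sets_pair_measure_cong[OF sets_distr sets_distr] refl])
  also have "\<dots> \<le> (\<integral>\<^sup>+x. c \<partial>distr M S X)"
  proof (rule nn_integral_mono)
    fix x assume "x \<in> space (distr M S X)"
    then have x: "x \<in> space S" by simp
    have "(\<lambda>y. \<psi> x y) \<in> borel_measurable T"
      using measurable_compose[OF measurable_Pair1'[OF x] meas] by simp
    then have "(\<integral>\<^sup>+y. \<psi> x y \<partial>distr M T Y) = (\<integral>\<^sup>+\<omega>. \<psi> x (Y \<omega>) \<partial>M)"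
      using Y by (subst nn_integral_distr) auto
    with le[OF x] show "(\<integral>\<^sup>+y. \<psi> x y \<partial>distr M T Y) \<le> c" by simp
  qed
  also have "\<dots> = c" using X.emeasure_space_1 by simp
  finally show ?thesis .
qed

end

section \<open>Dependence of iterates on the samples, and the mini-batch error\<close>

lemma borel_measurable_continuous_on_compose:
  assumes "continuous_on S k" "X \<in> borel_measurable N" "\<And>\<omega>. \<omega> \<in> space N \<Longrightarrow> X \<omega> \<in> S"
  shows "(\<lambda>\<omega>. k (X \<omega>)) \<in> borel_measurable N"
  using assms
  by (intro measurable_compose[OF _ borel_measurable_continuous_on_restrict[OF assms(1)]]
      measurable_restrict_space2) auto

text \<open>Iterate \<open>t\<close> reads only the batches before \<open>t\<close>. This is what
  makes it independent of batch \<open>t\<close>.\<close>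

lemma iterate_cong:
  assumes "\<And>i j. i < t \<Longrightarrow> j < b i \<Longrightarrow> s i j = s' i j"
  shows "iterate M Retr h g fs \<gamma> \<alpha> b s x0 t = iterate M Retr h g fs \<gamma> \<alpha> b s' x0 t"
  using assms
proof (induction t)
  case (Suc t)
  have "batch_grad fs (b t) (s t) = batch_grad fs (b t) (s' t)"
    using Suc.prems by (auto simp: batch_grad_def fun_eq_iff intro!: sum.cong)
  then show ?case using Suc by simp
qed simp

lemma batch_grad_minus:
  assumes "b \<ge> 1"
  shows "batch_grad fs b s x - u = (1 / real b) *\<^sub>R (\<Sum>j<b. grad (\<lambda>y. fs y (s j)) x - u)"
  using assms by (simp add: batch_grad_def sum_subtractf scaleR_diff_right sum_constant_scaleR)

lemma borel_measurable_batch_grad: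
  assumes sample_grad: "stochastic_oracle P fs f \<sigma>"
    and X: "X \<in> borel_measurable N" and Y: "\<And>j. j < b \<Longrightarrow> (\<lambda>\<omega>. Y \<omega> j) \<in> measurable N P"
  shows "(\<lambda>\<omega>. batch_grad fs b (Y \<omega>) (X \<omega>)) \<in> borel_measurable N"
proof -
  have G: "(\<lambda>p. grad (\<lambda>y. fs y (snd p)) (fst p)) \<in> borel_measurable (borel \<Otimes>\<^sub>M P)"
    using sample_grad by (intro borel_measurable_grad) (auto simp: stochastic_oracle_def)
  have "(\<lambda>\<omega>. grad (\<lambda>y. fs y (Y \<omega> j)) (X \<omega>)) \<in> borel_measurable N" if "j < b" for j
    using measurable_compose[OF measurable_Pair[OF X Y[OF that]] G] by simp
  then show ?thesis
    unfolding batch_grad_def by (intro borel_measurable_scaleR borel_measurable_sum) auto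
qed

text \<open>At a deterministic point the errors are independent and centred, so the second moment of
  their sum is at most \<open>b * \<sigma>\<^sup>2\<close>, and averaging divides it by the square
  of \<open>b\<close>.\<close>

lemma nn_integral_batch_grad_error_le:
  assumes sample_grad: "stochastic_oracle P fs f \<sigma>" and "prob_space \<Omega>" and b: "b \<ge> 1"
    and ind: "prob_space.indep_vars \<Omega> (\<lambda>_. P) Y {..<b}"
    and Y: "\<And>j. j < b \<Longrightarrow> Y j \<in> measurable \<Omega> P" and law: "\<And>j. j < b \<Longrightarrow> distr \<Omega> P (Y j) = P"
  shows "(\<integral>\<^sup>+\<omega>. ennreal ((norm (batch_grad fs b (\<lambda>j. Y j \<omega>) x - grad f x))\<^sup>2) \<partial>\<Omega>)
    \<le> ennreal (\<sigma>\<^sup>2 / real b)"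
proof -
  interpret prob_space \<Omega> by fact
  interpret P: prob_space P using sample_grad by (simp add: stochastic_oracle_def)
  define e where "e \<pi> = grad (\<lambda>y. fs y \<pi>) x - grad f x" for \<pi>
  have e: "integrable P e" "(\<integral>\<pi>. e \<pi> \<partial>P) = 0" "integrable P (\<lambda>\<pi>. (norm (e \<pi>))\<^sup>2)"
    "(\<integral>\<pi>. (norm (e \<pi>))\<^sup>2 \<partial>P) \<le> \<sigma>\<^sup>2"
  proof -
    let ?G = "\<lambda>\<pi>. grad (\<lambda>y. fs y \<pi>) x"
    have G: "integrable P ?G" "(\<integral>\<pi>. ?G \<pi> \<partial>P) = grad f x"
      using sample_grad unfolding stochastic_oracle_def by blast+
    then show "integrable P e" "(\<integral>\<pi>. e \<pi> \<partial>P) = 0" by (simp_all add: e_def[abs_def] P.prob_space)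
    show "integrable P (\<lambda>\<pi>. (norm (e \<pi>))\<^sup>2)" "(\<integral>\<pi>. (norm (e \<pi>))\<^sup>2 \<partial>P) \<le> \<sigma>\<^sup>2"
      using sample_grad unfolding stochastic_oracle_def e_def by blast+
  qed
  then have me: "e \<in> borel_measurable P" by simp
  let ?X = "\<lambda>j \<omega>. e (Y j \<omega>)"
  have ind': "indep_vars (\<lambda>_. borel) ?X {..<b}"
    by (rule indep_vars_compose2[OF ind me])
  have X: "integrable \<Omega> (?X j)" "expectation (?X j) = 0" "integrable \<Omega> (\<lambda>\<omega>. (norm (?X j \<omega>))\<^sup>2)"
    "expectation (\<lambda>\<omega>. (norm (?X j \<omega>))\<^sup>2) \<le> \<sigma>\<^sup>2" if "j < b" for j
  proof -
    note distr = integrable_distr_eq[OF Y[OF that], unfolded law[OF that]]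
      integral_distr[OF Y[OF that], unfolded law[OF that]]
    have me2: "(\<lambda>\<pi>. (norm (e \<pi>))\<^sup>2) \<in> borel_measurable P" using me by simp
    show "integrable \<Omega> (?X j)" "integrable \<Omega> (\<lambda>\<omega>. (norm (?X j \<omega>))\<^sup>2)"
      using e(1) e(3) distr(1)[OF me] distr(1)[OF me2] by blast+
    show "expectation (?X j) = 0" "expectation (\<lambda>\<omega>. (norm (?X j \<omega>))\<^sup>2) \<le> \<sigma>\<^sup>2"
      using e(2,4) distr(2)[OF me] distr(2)[OF me2] by simp_all
  qed
  have int: "integrable \<Omega> (\<lambda>\<omega>. (norm (\<Sum>j<b. ?X j \<omega>))\<^sup>2)"
    using ind' X by (intro integrable_norm_sum_indep) auto
  have "expectation (\<lambda>\<omega>. (norm (\<Sum>j<b. ?X j \<omega>))\<^sup>2) = (\<Sum>j<b. expectation (\<lambda>\<omega>. (norm (?X j \<omega>))\<^sup>2))"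
    using ind' X by (intro expectation_norm_sum_indep) auto
  also have "\<dots> \<le> (\<Sum>j<b. \<sigma>\<^sup>2)" using X by (intro sum_mono) auto
  finally have bound: "expectation (\<lambda>\<omega>. (norm (\<Sum>j<b. ?X j \<omega>))\<^sup>2) \<le> real b * \<sigma>\<^sup>2" by simp
  have eq: "(norm (batch_grad fs b (\<lambda>j. Y j \<omega>) x - grad f x))\<^sup>2 = (1 / real b)\<^sup>2 * (norm (\<Sum>j<b. ?X j \<omega>))\<^sup>2" for \<omega>
    unfolding batch_grad_minus[OF b] e_def norm_scaleR power_mult_distrib by simp
  have "(\<integral>\<^sup>+\<omega>. ennreal ((norm (batch_grad fs b (\<lambda>j. Y j \<omega>) x - grad f x))\<^sup>2) \<partial>\<Omega>)
      = ennreal (expectation (\<lambda>\<omega>. (1 / real b)\<^sup>2 * (norm (\<Sum>j<b. ?X j \<omega>))\<^sup>2))"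
    unfolding eq using int by (intro nn_integral_eq_integral integrable_mult_right) auto
  also have "expectation (\<lambda>\<omega>. (1 / real b)\<^sup>2 * (norm (\<Sum>j<b. ?X j \<omega>))\<^sup>2) \<le> (1 / real b)\<^sup>2 * (real b * \<sigma>\<^sup>2)"
    unfolding integral_mult_right_zero using bound by (intro mult_left_mono) auto
  also have "\<dots> = \<sigma>\<^sup>2 / real b" using b by (simp add: power2_eq_square)
  finally show ?thesis by (simp add: ennreal_leI)
qed

section \<open>Expected stationarity\<close>

context retraction_method
begin

lemma continuous_on_step:
  "continuous_on (UNIV \<times> M) (\<lambda>(u, x). Retr (x, \<alpha> *\<^sub>R bregman_direction M h g \<gamma> u x))"
proof -
  let ?k = "\<lambda>p. (snd p, \<alpha> *\<^sub>R (case p of (u, x) \<Rightarrow> bregman_direction M h g \<gamma> u x))"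
  have "continuous_on (UNIV \<times> M) ?k"
    by (intro continuous_intros continuous_on_bregman_direction[OF compact_M submanifold_M])
  moreover have "?k ` (UNIV \<times> M) \<subseteq> tangent_bundle M"
    by (auto simp: tangent_bundle_def intro!: subspace_scale bregman_direction_in subspace_T)
  ultimately have "continuous_on (UNIV \<times> M) (\<lambda>p. Retr (?k p))"
    by (rule continuous_on_compose2[OF continuous_on_retraction[OF retraction]])
  then show ?thesis by (simp add: case_prod_unfold)
qed

abbreviation "x_iter fs b s x0 \<equiv> iterate M Retr h g fs (\<lambda>_. \<gamma>) (\<lambda>_. \<alpha>) (\<lambda>_. b) s x0"

lemma iterate_in:
  assumes "x0 \<in> M"
  shows "x_iter fs b s x0 t \<in> M"
  using assms
  by (induction t)
     (auto simp: Let_def intro!: Retr_in subspace_scale bregman_direction_in subspace_T)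

text \<open>The sample space \<open>N\<close> is left general: the lemma is used on \<Omega> and
  again on the product space of past samples.\<close>

lemma borel_measurable_iterate:
  assumes "stochastic_oracle P fs f \<sigma>" "x0 \<in> M"
    and "\<And>i j. i < t \<Longrightarrow> j < b \<Longrightarrow> (\<lambda>\<omega>. s \<omega> i j) \<in> measurable N P"
  shows "(\<lambda>\<omega>. x_iter fs b (s \<omega>) x0 t) \<in> borel_measurable N"
  using assms(3)
proof (induction t)
  case (Suc t)
  have IH: "(\<lambda>\<omega>. x_iter fs b (s \<omega>) x0 t) \<in> borel_measurable N"
    using Suc.prems by (intro Suc.IH) auto
  have "(\<lambda>\<omega>. batch_grad fs b (s \<omega> t) (x_iter fs b (s \<omega>) x0 t)) \<in> borel_measurable N"
    using Suc.prems by (intro borel_measurable_batch_grad[OF assms(1) IH]) auto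
  from borel_measurable_Pair[OF this IH]
  have "(\<lambda>\<omega>. case (batch_grad fs b (s \<omega> t) (x_iter fs b (s \<omega>) x0 t), x_iter fs b (s \<omega>) x0 t) of
      (u, x) \<Rightarrow> Retr (x, \<alpha> *\<^sub>R bregman_direction M h g \<gamma> u x)) \<in> borel_measurable N"
    by (rule borel_measurable_continuous_on_compose[OF continuous_on_step])
       (simp add: iterate_in assms(2))
  then show ?case by (simp add: Let_def)
qed simp

lemma expected_stationarity_bound:
  assumes sample_grad: "stochastic_oracle P fs f \<sigma>" and x0: "x0 \<in> M" and b: "b \<ge> 1"
    and iid: "iid_samples \<Omega> P \<xi> ({..<T} \<times> {..<b})"
    and Fstar: "\<And>x. x \<in> M \<Longrightarrow> Fstar \<le> f x + g x"
  defines "v \<equiv> \<lambda>t \<omega>. stationarity_direction M Retr h g f fs (\<lambda>_. \<gamma>) (\<lambda>_. \<alpha>) (\<lambda>_. b)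
    (\<lambda>t j. \<xi> t j \<omega>) x0 t"
  shows "t < T \<Longrightarrow> integrable \<Omega> (\<lambda>\<omega>. (norm (v t \<omega>))\<^sup>2)"
    and "(\<Sum>t<T. \<integral>\<omega>. (norm (v t \<omega>))\<^sup>2 \<partial>\<Omega>)
      \<le> 16 / (\<alpha> * (\<gamma> * \<mu>)) * (f x0 + g x0 - Fstar) + 18 / (\<gamma> * \<mu>)\<^sup>2 * (real T * (\<sigma>\<^sup>2 / real b))"
proof -
  have "prob_space \<Omega>" using iid by (simp add: iid_samples_def)
  then interpret prob_space \<Omega> .
  have \<xi>: "\<xi> t j \<in> measurable \<Omega> P" "distr \<Omega> P (\<xi> t j) = P" if "t < T" "j < b" for t j
    using iid that by (auto simp: iid_samples_def)
  have indep: "indep_vars (\<lambda>_. P) (\<lambda>(t, j). \<xi> t j) ({..<T} \<times> {..<b})"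
    using iid by (simp add: iid_samples_def)
  define X where "X t \<omega> = x_iter fs b (\<lambda>t j. \<xi> t j \<omega>) x0 t" for t \<omega>
  define u where "u t \<omega> = batch_grad fs b (\<lambda>j. \<xi> t j \<omega>) (X t \<omega>)" for t \<omega>
  define \<delta> where "\<delta> t \<omega> = u t \<omega> - grad f (X t \<omega>)" for t \<omega>
  have X_in: "X t \<omega> \<in> M" for t \<omega> unfolding X_def by (rule iterate_in[OF x0])
  have X_meas: "X t \<in> borel_measurable \<Omega>" if "t \<le> T" for t
    unfolding X_def[abs_def] using that \<xi> by (intro borel_measurable_iterate[OF sample_grad x0]) auto
  have cont_grad: "continuous_on UNIV (grad f)"
    using f_diff by (simp add: continuously_differentiable_def)
  have v_eq: "v t \<omega> = bregman_direction M h g \<gamma> (grad f (X t \<omega>)) (X t \<omega>)" for t \<omega>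
    by (simp add: v_def stationarity_direction_def X_def Let_def)
  have grad_meas: "(\<lambda>\<omega>. grad f (X t \<omega>)) \<in> borel_measurable \<Omega>" if "t \<le> T" for t
    using borel_measurable_continuous_on_compose[OF cont_grad X_meas[OF that]] by simp
  have v_meas: "v t \<in> borel_measurable \<Omega>" if "t \<le> T" for t
  proof -
    have "(\<lambda>\<omega>. case (grad f (X t \<omega>), X t \<omega>) of (u, x) \<Rightarrow> bregman_direction M h g \<gamma> u x) \<in> borel_measurable \<Omega>"
      by (rule borel_measurable_continuous_on_compose[OF
            continuous_on_bregman_direction[OF compact_M submanifold_M]
            borel_measurable_Pair[OF grad_meas[OF that] X_meas[OF that]]]) (simp add: X_in)
    then show ?thesis by (simp add: v_eq[abs_def])
  qed
  \<comment> \<open>The exact directions are uniformly bounded on \<open>M\<close>, which gives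
    integrability of their squared norms on a probability space.\<close>
  have v_bound: "norm (v t \<omega>) \<le> 2 * (G\<^sub>f + L\<^sub>g) / (\<gamma> * \<mu>)" for t \<omega>
  proof -
    have "norm (v t \<omega>) \<le> 2 * (norm (grad f (X t \<omega>)) + L\<^sub>g) / (\<gamma> * \<mu>)"
      unfolding v_eq by (rule bregman_direction_norm[OF subspace_T[OF X_in]])
    also have "\<dots> \<le> 2 * (G\<^sub>f + L\<^sub>g) / (\<gamma> * \<mu>)"
      using G\<^sub>f[OF X_in] gamma_mu_pos by (intro divide_right_mono) auto
    finally show ?thesis .
  qed
  have v_int: "integrable \<Omega> (\<lambda>\<omega>. (norm (v t \<omega>))\<^sup>2)" if "t < T" for t
    using v_meas[of t] that v_bound
    by (intro integrable_const_bound[where B = "(2 * (G\<^sub>f + L\<^sub>g) / (\<gamma> * \<mu>))\<^sup>2"])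
       (auto intro!: power_mono)
  then show "t < T \<Longrightarrow> integrable \<Omega> (\<lambda>\<omega>. (norm (v t \<omega>))\<^sup>2)" .

  have \<delta>: "integrable \<Omega> (\<lambda>\<omega>. (norm (\<delta> t \<omega>))\<^sup>2) \<and> expectation (\<lambda>\<omega>. (norm (\<delta> t \<omega>))\<^sup>2) \<le> \<sigma>\<^sup>2 / real b"
    if t: "t < T" for t
  proof -
    \<comment> \<open>The index sets of past samples and of the current batch are disjoint, so joint
      independence makes the two sample vectors independent.\<close>
    let ?A = "{..<t} \<times> {..<b}" and ?B = "{t} \<times> {..<b}"
    let ?past = "\<lambda>\<omega>. \<lambda>i\<in>?A. (case i of (t, j) \<Rightarrow> \<xi> t j) \<omega>"
    let ?now = "\<lambda>\<omega>. \<lambda>i\<in>?B. (case i of (t, j) \<Rightarrow> \<xi> t j) \<omega>"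
    have ind: "indep_var (PiM ?A (\<lambda>_. P)) ?past (PiM ?B (\<lambda>_. P)) ?now"
      using t by (intro indep_var_restrict[OF indep]) auto
    define \<Phi> where "\<Phi> y = x_iter fs b (\<lambda>t j. y (t, j)) x0 t" for y
    have \<Phi>_meas: "\<Phi> \<in> borel_measurable (PiM ?A (\<lambda>_. P))"
      unfolding \<Phi>_def[abs_def] by (rule borel_measurable_iterate[OF sample_grad x0]) simp
    have past: "\<Phi> (?past \<omega>) = X t \<omega>" for \<omega>
      unfolding \<Phi>_def X_def by (rule iterate_cong) simp
    have batch: "batch_grad fs b (\<lambda>j. ?now \<omega> (t, j)) = batch_grad fs b (\<lambda>j. \<xi> t j \<omega>)" for \<omega>
      by (auto simp: batch_grad_def fun_eq_iff intro!: sum.cong)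
    \<comment> \<open>\<^const>\<open>indep_var\<close> requires both variables to have the same range type, so the past is kept as a
      vector of samples instead of being replaced by the iterate it determines.\<close>
    let ?\<psi> = "\<lambda>y z. ennreal ((norm (batch_grad fs b (\<lambda>j. z (t, j)) (\<Phi> y) - grad f (\<Phi> y)))\<^sup>2)"
    have "(\<integral>\<^sup>+\<omega>. ?\<psi> (?past \<omega>) (?now \<omega>) \<partial>\<Omega>) \<le> ennreal (\<sigma>\<^sup>2 / real b)"
    proof (rule nn_integral_indep_var_le[OF ind])
      let ?N = "PiM ?A (\<lambda>_. P) \<Otimes>\<^sub>M PiM ?B (\<lambda>_. P)"
      have fst_meas: "(\<lambda>p. \<Phi> (fst p)) \<in> borel_measurable ?N"
        by (rule measurable_compose[OF measurable_fst \<Phi>_meas])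
      have "(\<lambda>p. batch_grad fs b (\<lambda>j. snd p (t, j)) (\<Phi> (fst p))) \<in> borel_measurable ?N"
        by (intro borel_measurable_batch_grad[OF sample_grad fst_meas]
            measurable_compose[OF measurable_snd measurable_component_singleton]) simp
      moreover have "(\<lambda>p. grad f (\<Phi> (fst p))) \<in> borel_measurable ?N"
        using borel_measurable_continuous_on_compose[OF cont_grad fst_meas] by simp
      ultimately show "(\<lambda>p. ?\<psi> (fst p) (snd p)) \<in> borel_measurable ?N"
        by simp
      show "(\<integral>\<^sup>+\<omega>. ?\<psi> y (?now \<omega>) \<partial>\<Omega>) \<le> ennreal (\<sigma>\<^sup>2 / real b)" for y
      proof -
        \<comment> \<open>Reindexing from pairs to \<open>j\<close>: group the pairs into
          singletons, then project each block to its only component.\<close>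
        have "indep_vars (\<lambda>_. P) (\<lambda>j. \<xi> t j) {..<b}"
        proof -
          have "indep_vars (\<lambda>j. PiM {(t, j)} (\<lambda>_. P))
              (\<lambda>j \<omega>. \<lambda>i\<in>{(t, j)}. (case i of (t, j) \<Rightarrow> \<xi> t j) \<omega>) {..<b}"
            using t by (intro indep_vars_restrict[OF indep]) (auto simp: disjoint_family_on_def)
          from indep_vars_compose2[OF this, of "\<lambda>j y. y (t, j)" "\<lambda>_. P"] show ?thesis by simp
        qed
        then show ?thesis
          unfolding batch
          by (intro nn_integral_batch_grad_error_le[OF sample_grad \<open>prob_space \<Omega>\<close> b] \<xi> t)
      qed
    qed
    then have nn: "(\<integral>\<^sup>+\<omega>. ennreal ((norm (\<delta> t \<omega>))\<^sup>2) \<partial>\<Omega>) \<le> ennreal (\<sigma>\<^sup>2 / real b)"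
      unfolding past batch \<delta>_def u_def .
    have "u t \<in> borel_measurable \<Omega>"
      unfolding u_def[abs_def]
      using t \<xi> by (intro borel_measurable_batch_grad[OF sample_grad X_meas]) auto
    then have m: "\<delta> t \<in> borel_measurable \<Omega>"
      unfolding \<delta>_def[abs_def] using grad_meas[of t] t by simp
    \<comment> \<open>Integrability of the squared error is obtained from the finite nonnegative
      integral just bounded.\<close>
    have int: "integrable \<Omega> (\<lambda>\<omega>. (norm (\<delta> t \<omega>))\<^sup>2)"
      using m le_less_trans[OF nn ennreal_less_top] by (intro integrableI_nonneg) auto
    have "ennreal (expectation (\<lambda>\<omega>. (norm (\<delta> t \<omega>))\<^sup>2)) \<le> ennreal (\<sigma>\<^sup>2 / real b)"
      using nn nn_integral_eq_integral[OF int] by simp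
    then show ?thesis using int by (simp add: ennreal_le_iff)
  qed
  have step: "(norm (v t \<omega>))\<^sup>2 \<le> 16 / (\<alpha> * (\<gamma> * \<mu>)) *
      (f (X t \<omega>) + g (X t \<omega>) - (f (X (Suc t) \<omega>) + g (X (Suc t) \<omega>)))
      + 18 / (\<gamma> * \<mu>)\<^sup>2 * (norm (\<delta> t \<omega>))\<^sup>2" for t \<omega>
  proof -
    have "X (Suc t) \<omega> = Retr (X t \<omega>, \<alpha> *\<^sub>R bregman_direction M h g \<gamma> (u t \<omega>) (X t \<omega>))"
      by (simp add: X_def u_def Let_def)
    then show ?thesis
      unfolding v_eq \<delta>_def using one_step[OF X_in, of t \<omega> "u t \<omega>"] by simp
  qed
  have path: "(\<Sum>t<T. (norm (v t \<omega>))\<^sup>2) \<le> 16 / (\<alpha> * (\<gamma> * \<mu>)) * (f x0 + g x0 - Fstar)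
      + 18 / (\<gamma> * \<mu>)\<^sup>2 * (\<Sum>t<T. (norm (\<delta> t \<omega>))\<^sup>2)" for \<omega>
  proof -
    let ?F = "\<lambda>t. f (X t \<omega>) + g (X t \<omega>)"
    have "(\<Sum>t<T. (norm (v t \<omega>))\<^sup>2) \<le> (\<Sum>t<T. 16 / (\<alpha> * (\<gamma> * \<mu>)) * (?F t - ?F (Suc t))
        + 18 / (\<gamma> * \<mu>)\<^sup>2 * (norm (\<delta> t \<omega>))\<^sup>2)"
      by (intro sum_mono step)
    also have "\<dots> = 16 / (\<alpha> * (\<gamma> * \<mu>)) * (?F 0 - ?F T) + 18 / (\<gamma> * \<mu>)\<^sup>2 * (\<Sum>t<T. (norm (\<delta> t \<omega>))\<^sup>2)"
      by (simp only: sum.distrib sum_distrib_left[symmetric] sum_lessThan_telescope'[of ?F T])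
    \<comment> \<open>After telescoping, only the last objective value is left to estimate, and it
      is at least \<open>Fstar\<close> because the iterate lies in \<open>M\<close>.\<close>
    also have "16 / (\<alpha> * (\<gamma> * \<mu>)) * (?F 0 - ?F T) \<le> 16 / (\<alpha> * (\<gamma> * \<mu>)) * (f x0 + g x0 - Fstar)"
    proof (rule mult_left_mono)
      show "?F 0 - ?F T \<le> f x0 + g x0 - Fstar" using Fstar[OF X_in[of T \<omega>]] by (simp add: X_def)
      show "0 \<le> 16 / (\<alpha> * (\<gamma> * \<mu>))" using alpha_pos gamma_mu_pos by simp
    qed
    finally show ?thesis by simp
  qed
  have affine: "expectation (\<lambda>\<omega>. a + c * S \<omega>) = a + c * expectation S" if "integrable \<Omega> S"
    for a c :: real and S
    using that by (simp add: prob_space)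
  have "(\<Sum>t<T. \<integral>\<omega>. (norm (v t \<omega>))\<^sup>2 \<partial>\<Omega>) = (\<integral>\<omega>. (\<Sum>t<T. (norm (v t \<omega>))\<^sup>2) \<partial>\<Omega>)"
    using v_int by (intro Bochner_Integration.integral_sum[symmetric]) auto
  also have "\<dots> \<le> (\<integral>\<omega>. 16 / (\<alpha> * (\<gamma> * \<mu>)) * (f x0 + g x0 - Fstar)
      + 18 / (\<gamma> * \<mu>)\<^sup>2 * (\<Sum>t<T. (norm (\<delta> t \<omega>))\<^sup>2) \<partial>\<Omega>)"
  proof (rule integral_mono[OF _ _ path])
    show "integrable \<Omega> (\<lambda>\<omega>. \<Sum>t<T. (norm (v t \<omega>))\<^sup>2)" using v_int by auto
    show "integrable \<Omega> (\<lambda>\<omega>. 16 / (\<alpha> * (\<gamma> * \<mu>)) * (f x0 + g x0 - Fstar)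
        + 18 / (\<gamma> * \<mu>)\<^sup>2 * (\<Sum>t<T. (norm (\<delta> t \<omega>))\<^sup>2))"
      by (intro Bochner_Integration.integrable_add integrable_const integrable_mult_right
          Bochner_Integration.integrable_sum) (use \<delta> in auto)
  qed
  also have "\<dots> = 16 / (\<alpha> * (\<gamma> * \<mu>)) * (f x0 + g x0 - Fstar)
      + 18 / (\<gamma> * \<mu>)\<^sup>2 * (\<Sum>t<T. expectation (\<lambda>\<omega>. (norm (\<delta> t \<omega>))\<^sup>2))"
    using \<delta> by (subst affine) (auto simp: Bochner_Integration.integral_sum)
  also have "\<dots> \<le> 16 / (\<alpha> * (\<gamma> * \<mu>)) * (f x0 + g x0 - Fstar)
      + 18 / (\<gamma> * \<mu>)\<^sup>2 * (real T * (\<sigma>\<^sup>2 / real b))"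
  proof (intro add_left_mono mult_left_mono)
    have "(\<Sum>t<T. expectation (\<lambda>\<omega>. (norm (\<delta> t \<omega>))\<^sup>2)) \<le> (\<Sum>t<T. \<sigma>\<^sup>2 / real b)"
      using \<delta> by (intro sum_mono) auto
    then show "(\<Sum>t<T. expectation (\<lambda>\<omega>. (norm (\<delta> t \<omega>))\<^sup>2)) \<le> real T * (\<sigma>\<^sup>2 / real b)" by simp
  qed simp
  finally show "(\<Sum>t<T. \<integral>\<omega>. (norm (v t \<omega>))\<^sup>2 \<partial>\<Omega>)
      \<le> 16 / (\<alpha> * (\<gamma> * \<mu>)) * (f x0 + g x0 - Fstar) + 18 / (\<gamma> * \<mu>)\<^sup>2 * (real T * (\<sigma>\<^sup>2 / real b))" .
qed

end

text \<open>Choosing \<open>C\<close> before the oracle, the samples, \<open>x0\<close>,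
  \<open>T\<close>, \<open>B\<close> and \<sigma> expresses the independence of the hidden constant.
  Integrability belongs to the conclusion because a non-integrable square would have Bochner
  integral 0 and satisfy the bound for the wrong reason.\<close>

theorem theorem5p1:
  fixes M :: "'a::euclidean_space set"
    and d :: nat
    and Retr :: "'a \<times> 'a \<Rightarrow> 'a"
    and f g h :: "'a \<Rightarrow> real"
    and \<gamma> \<alpha> \<mu> L L\<^sub>g M1 M2 G\<^sub>f G\<^sub>h Fstar :: real
  assumes "compact M" and "embedded_submanifold d M"
    and "retraction_on_manifold M Retr"
    and "M1 > 0" and "\<forall>x\<in>M. \<forall>v\<in>tangent_space M x. norm (Retr (x, v) - x) \<le> M1 * norm v"
    and "M2 > 0" and "\<forall>x\<in>M. \<forall>v\<in>tangent_space M x. norm (Retr (x, v) - (x + v)) \<le> M2 * (norm v)\<^sup>2"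
    and "continuously_differentiable f"
    and "convex_on UNIV g" and "L\<^sub>g-lipschitz_on UNIV g"
    and "bdd_below ((\<lambda>x. f x + g x) ` M)" and "Fstar = (INF x\<in>M. f x + g x)"
    and "continuously_differentiable h" and "\<mu> > 0" and "strongly_convex \<mu> h"
    and "L > 0" and "relatively_smooth L h f"
    and "G\<^sub>f = (SUP x\<in>M. norm (grad f x))" and "G\<^sub>h = (SUP x\<in>M. norm (grad h x))"
    and "\<gamma> \<ge> L"
    and "0 < \<alpha>" and "\<alpha> < \<gamma> * \<mu> / (8 * (G\<^sub>f + 2 * \<gamma> * G\<^sub>h + L\<^sub>g) * M2)"
  shows "\<exists>C>0. \<forall>(P :: 'p measure) (fs :: 'a \<Rightarrow> 'p \<Rightarrow> real) (\<sigma> :: real)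
            (\<Omega> :: 'w measure) (\<xi> :: nat \<Rightarrow> nat \<Rightarrow> 'w \<Rightarrow> 'p) (x0 :: 'a) (T :: nat) (B :: nat).
          \<sigma> > 0 \<and> stochastic_oracle P fs f \<sigma> \<and> x0 \<in> M \<and> T \<ge> 1 \<and> B \<ge> 1 \<and>
          iid_samples \<Omega> P \<xi> ({..<T} \<times> {..<B}) \<longrightarrow>
          (let v = (\<lambda>t \<omega>. stationarity_direction M Retr h g f fs (\<lambda>_. \<gamma>) (\<lambda>_. \<alpha>) (\<lambda>_. B)
                             (\<lambda>t j. \<xi> t j \<omega>) x0 t)
           in (\<forall>t<T. integrable \<Omega> (\<lambda>\<omega>. (norm (v t \<omega>))\<^sup>2)) \<and>
              1 / real T * (\<Sum>t<T. \<integral>\<omega>. (norm (v t \<omega>))\<^sup>2 \<partial>\<Omega>)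
                \<le> C * ((f x0 + g x0 - Fstar) / real T + \<sigma>\<^sup>2 / real B))"
proof (cases "M = {}")
  case True
  then show ?thesis by (intro exI[of _ 1]) auto
next
  case False
  note A = assms
  have "0 < \<gamma>" using \<open>L > 0\<close> \<open>\<gamma> \<ge> L\<close> by simp
  interpret retraction_method h g \<gamma> \<mu> L\<^sub>g M d Retr f L M2 G\<^sub>f G\<^sub>h \<alpha>
  proof
    show "norm (grad f x) \<le> G\<^sub>f" if "x \<in> M" for x
      unfolding \<open>G\<^sub>f = _\<close> using that bdd_above_norm_grad[OF A(1)] A(8) by (intro cSUP_upper) auto
    show "norm (grad h x) \<le> G\<^sub>h" if "x \<in> M" for x
      unfolding \<open>G\<^sub>h = _\<close> using that bdd_above_norm_grad[OF A(1)] A(13) by (intro cSUP_upper) auto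
    show "norm (Retr (x, v) - (x + v)) \<le> M2 * (norm v)\<^sup>2" if "x \<in> M" "v \<in> tangent_space M x" for x v
      using A(7) that by blast
  qed (fact A \<open>0 < \<gamma>\<close>)+
  have Fstar: "Fstar \<le> f x + g x" if "x \<in> M" for x
    unfolding \<open>Fstar = _\<close> using that A(11) by (intro cINF_lower) auto
  \<comment> \<open>Both constants are built from \<alpha>, \<gamma> and \<mu> alone.\<close>
  define C1 C2 where "C1 = 16 / (\<alpha> * (\<gamma> * \<mu>))" and "C2 = 18 / (\<gamma> * \<mu>)\<^sup>2"
  have C: "0 < C1" "0 < C2" using alpha_pos gamma_pos mu_pos by (simp_all add: C1_def C2_def)
  show ?thesis
  proof (intro exI[of _ "C1 + C2"] conjI allI impI; (elim conjE)?)
    show "0 < C1 + C2" using C by simp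
  next
    fix P :: "'p measure" and fs :: "'a \<Rightarrow> 'p \<Rightarrow> real" and \<sigma> :: real
      and \<Omega> :: "'w measure" and \<xi> :: "nat \<Rightarrow> nat \<Rightarrow> 'w \<Rightarrow> 'p" and x0 :: 'a and T B :: nat
    assume sg: "stochastic_oracle P fs f \<sigma>" and x0: "x0 \<in> M" and T: "T \<ge> 1" and B: "B \<ge> 1"
      and iid: "iid_samples \<Omega> P \<xi> ({..<T} \<times> {..<B})"
    define v where "v = (\<lambda>t \<omega>. stationarity_direction M Retr h g f fs (\<lambda>_. \<gamma>) (\<lambda>_. \<alpha>) (\<lambda>_. B)
      (\<lambda>t j. \<xi> t j \<omega>) x0 t)"
    let ?D = "f x0 + g x0 - Fstar" and ?S = "\<sigma>\<^sup>2 / real B"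
    have bound: "\<forall>t<T. integrable \<Omega> (\<lambda>\<omega>. (norm (v t \<omega>))\<^sup>2)"
      "(\<Sum>t<T. \<integral>\<omega>. (norm (v t \<omega>))\<^sup>2 \<partial>\<Omega>) \<le> C1 * ?D + C2 * (real T * ?S)"
      unfolding v_def C1_def C2_def using expected_stationarity_bound[OF sg x0 B iid Fstar] by blast+
    have "1 / real T * (\<Sum>t<T. \<integral>\<omega>. (norm (v t \<omega>))\<^sup>2 \<partial>\<Omega>)
        \<le> 1 / real T * (C1 * ?D + C2 * (real T * ?S))"
      using bound(2) by (intro mult_left_mono) auto
    also have "\<dots> = C1 * (?D / real T) + C2 * ?S" using T by (simp add: field_simps)
    \<comment> \<open>Both terms are nonnegative, the first because \<open>Fstar\<close> is at most
      the initial value, so each coefficient may be enlarged to the sum.\<close>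
    also have "\<dots> \<le> (C1 + C2) * (?D / real T) + (C1 + C2) * ?S"
      using C Fstar[OF x0] by (intro add_mono mult_right_mono) auto
    finally have "1 / real T * (\<Sum>t<T. \<integral>\<omega>. (norm (v t \<omega>))\<^sup>2 \<partial>\<Omega>) \<le> (C1 + C2) * (?D / real T + ?S)"
      by (simp only: distrib_left)
    with bound(1) show "let v = (\<lambda>t \<omega>. stationarity_direction M Retr h g f fs (\<lambda>_. \<gamma>) (\<lambda>_. \<alpha>) (\<lambda>_. B)
          (\<lambda>t j. \<xi> t j \<omega>) x0 t)
        in (\<forall>t<T. integrable \<Omega> (\<lambda>\<omega>. (norm (v t \<omega>))\<^sup>2)) \<and>
          1 / real T * (\<Sum>t<T. \<integral>\<omega>. (norm (v t \<omega>))\<^sup>2 \<partial>\<Omega>) \<le> (C1 + C2) * (?D / real T + ?S)"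
      unfolding Let_def v_def[symmetric] by blast
  qed
qed

end
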